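(* Let $\Psi$ be the manifold of euclidean planes of the $3$-dimensional pseudo-euclidean space $E(2,1)$, let $G=PSL_2(\mathbb{R})\ltimes\mathbb{R}^3$ be the connected component of its motion group, and let $\Sigma$ be the set of motions $Y\mapsto A^{-1}YA$ with $A\in\exp\langle\mathcal{H},\mathcal{T}\rangle\subset PSL_2(\mathbb{R})$. Let $\Lambda$ be a $1$-dimensional translation group leaving invariant a line $S$ which contains the origin and intersects every plane of $\Psi$ in precisely one point. Then the set $\Theta=\Lambda\Sigma=\{\omega\circ\delta:\omega\in\Lambda,\delta\in\Sigma\}$ acts sharply transitively on $\Psi$ (for all $D_1,D_2\in\Psi$ there is precisely one $\rho\in\Theta$ with $\rho(D_1)=D_2$). Moreover, for a plane $P\in\Psi$ containing the origin, the multiplication $X\cdot Y=\rho_X(Y)$ on $\Psi$, where $\rho_X$ is the unique element of $\Theta$ with $\rho_X(P)=X$, defines a $3$-dimensional differentiable loop $L_\Lambda$ with identity $P$ having $G$ as the group topologically generated by its left translations, and $L_\Lambda$ is not a Bol loop.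
   Context: $\mathcal{H}=\begin{pmatrix}1&0\\0&-1\end{pmatrix}$, $\mathcal{T}=\begin{pmatrix}0&1\\1&0\end{pmatrix}$. $E(2,1)$ is the affine space of real $2\times2$ matrices of trace $0$, $Y=\begin{pmatrix}x&k+l\\k-l&-x\end{pmatrix}$, with norm $x^2+k^2-l^2$; the origin is $Y=0$. The elements $(A,X)$ of $G$ ($A\in PSL_2(\mathbb{R})$, $X$ a real trace-$0$ matrix) induce the motions $Y\mapsto A^{-1}YA+X$; the translations are those with $A=1$. The euclidean planes, forming $\Psi$, are the affine planes on whose direction space the norm is positive definite; equivalently, the planes whose line at infinity does not meet the conic $x^2+k^2=l^2$ in the plane at infinity. The set $\exp\langle\mathcal{H},\mathcal{T}\rangle$ is the image of the section defining the hyperbolic plane loop. A loop is a set with a binary operation having a two-sided identity and such that $a\cdot y=b$ and $x\cdot a=b$ have unique solutions $y=a\backslash b$, $x=b/a$. The left translation by $a$ is $\lambda_a:y\mapsto a\cdot y$. It is a Bol loop if for all $a,b$ the map $\lambda_a\lambda_b\lambda_a$ is again a left translation. A loop on a differentiable manifold is differentiable if $(x,y)\mapsto x\cdot y,\ x/y,\ x\backslash y$ are differentiable. *)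

theory Defs
  imports "HOL-Analysis.Analysis" "HOL-Algebra.Bij" "HOL-Algebra.Generated_Groups"
begin

section \<open>The space \<open>E(2,1)\<close> and its euclidean planes\<close>

definition E21 :: "(real^2^2) set" where
  "E21 = {Y. trace Y = 0}"

text \<open>The coordinates \<open>x\<close>, \<open>k\<close>, \<open>l\<close> of the matrix with rows \<open>(x, k + l)\<close> and \<open>(k - l, -x)\<close>.\<close>

definition xco :: "real^2^2 \<Rightarrow> real" where
  "xco Y = Y $ 1 $ 1"

definition kco :: "real^2^2 \<Rightarrow> real" where
  "kco Y = (Y $ 1 $ 2 + Y $ 2 $ 1) / 2"

definition lco :: "real^2^2 \<Rightarrow> real" where
  "lco Y = (Y $ 1 $ 2 - Y $ 2 $ 1) / 2"

definition pnorm :: "real^2^2 \<Rightarrow> real" where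
  "pnorm Y = (xco Y)\<^sup>2 + (kco Y)\<^sup>2 - (lco Y)\<^sup>2"

definition is_line :: "(real^2^2) set \<Rightarrow> bool" where
  "is_line S \<longleftrightarrow> S \<subseteq> E21 \<and> affine S \<and> aff_dim S = 1"

definition is_plane :: "(real^2^2) set \<Rightarrow> bool" where
  "is_plane D \<longleftrightarrow> D \<subseteq> E21 \<and> affine D \<and> aff_dim D = 2"

definition direction_space :: "(real^2^2) set \<Rightarrow> (real^2^2) set" where
  "direction_space D = {Y - Z | Y Z. Y \<in> D \<and> Z \<in> D}"

definition euclidean_planes :: "(real^2^2) set set"  (\<open>\<Psi>\<close>) where
  "\<Psi> = {D. is_plane D \<and> (\<forall>V \<in> direction_space D. V \<noteq> 0 \<longrightarrow> pnorm V > 0)}"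


section \<open>Motions\<close>

definition SL2 :: "(real^2^2) set" where
  "SL2 = {A. det A = 1}"

text \<open>Since \<open>A\<close> and \<open>-A\<close> induce the same motion, matrices in \<open>SL2\<close> serve as representatives
  of the elements of \<open>PSL\<^sub>2(\<real>)\<close>. Motions are extensional maps on \<open>E21\<close>.\<close>

definition motion :: "real^2^2 \<Rightarrow> real^2^2 \<Rightarrow> (real^2^2 \<Rightarrow> real^2^2)" where
  "motion A X = (\<lambda>Y \<in> E21. matrix_inv A ** Y ** A + X)"

definition motion_group :: "(real^2^2 \<Rightarrow> real^2^2) set" where
  "motion_group = {motion A X | A X. A \<in> SL2 \<and> X \<in> E21}"

text \<open>The topology of \<open>PSL\<^sub>2(\<real>) \<ltimes> \<real>\<^sup>3\<close>: the quotient topology with respect to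
  \<open>(A, X) \<mapsto> motion A X\<close>.\<close>

definition motion_open :: "(real^2^2 \<Rightarrow> real^2^2) set \<Rightarrow> bool" where
  "motion_open U \<longleftrightarrow> U \<subseteq> motion_group \<and>
     openin (top_of_set (SL2 \<times> E21)) {(A, X). A \<in> SL2 \<and> X \<in> E21 \<and> motion A X \<in> U}"

definition motion_topology :: "(real^2^2 \<Rightarrow> real^2^2) topology" where
  "motion_topology = topology motion_open"

lemma istopology_motion_open: "istopology motion_open"
  unfolding istopology_def
proof (intro conjI allI impI)
  let ?pre = "\<lambda>U. {(A, X). A \<in> SL2 \<and> X \<in> E21 \<and> motion A X \<in> U}"
  fix S T assume "motion_open S" "motion_open T"
  moreover have "?pre (S \<inter> T) = ?pre S \<inter> ?pre T" by auto
  ultimately show "motion_open (S \<inter> T)"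
    unfolding motion_open_def by (metis (no_types, lifting) le_infI1 openin_Int)
next
  let ?pre = "\<lambda>U. {(A, X). A \<in> SL2 \<and> X \<in> E21 \<and> motion A X \<in> U}"
  fix K assume K: "\<forall>U \<in> K. motion_open U"
  have eq: "?pre (\<Union>K) = \<Union>(?pre ` K)" by auto
  have "openin (top_of_set (SL2 \<times> E21)) (\<Union>(?pre ` K))"
    using K by (intro openin_Union) (auto simp: motion_open_def)
  then show "motion_open (\<Union>K)"
    using K unfolding motion_open_def eq by auto
qed

lemma openin_motion_topology: "openin motion_topology U \<longleftrightarrow> motion_open U"
  by (simp add: motion_topology_def topology_inverse' istopology_motion_open)

text \<open>The matrix exponential; the type \<open>real^2^2\<close> carries no Banach algebra structure, so
  the library constant \<open>exp\<close> is not applicable.\<close>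

definition matrix_exp :: "real^2^2 \<Rightarrow> real^2^2" where
  "matrix_exp M = (\<Sum>n. (1 / fact n) *\<^sub>R (((**) M) ^^ n) (mat 1))"

definition matH :: "real^2^2" where
  "matH = vector [vector [1, 0], vector [0, -1]]"

definition matT :: "real^2^2" where
  "matT = vector [vector [0, 1], vector [1, 0]]"

definition Sigma_motions :: "(real^2^2 \<Rightarrow> real^2^2) set" where
  "Sigma_motions = {motion A 0 | A. A \<in> matrix_exp ` span {matH, matT}}"

definition translation :: "real^2^2 \<Rightarrow> (real^2^2 \<Rightarrow> real^2^2)" where
  "translation X = motion (mat 1) X"

definition one_dim_translation_group :: "(real^2^2 \<Rightarrow> real^2^2) set \<Rightarrow> bool" where
  "one_dim_translation_group \<Lambda> \<longleftrightarrow>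
     (\<exists>W. W \<subseteq> E21 \<and> subspace W \<and> dim W = 1 \<and> \<Lambda> = translation ` W)"

definition Theta_motions ::
  "(real^2^2 \<Rightarrow> real^2^2) set \<Rightarrow> (real^2^2 \<Rightarrow> real^2^2) set" where
  "Theta_motions \<Lambda> = {compose E21 \<omega> \<delta> | \<omega> \<delta>. \<omega> \<in> \<Lambda> \<and> \<delta> \<in> Sigma_motions}"

definition sharply_transitive_on_planes :: "(real^2^2 \<Rightarrow> real^2^2) set \<Rightarrow> bool" where
  "sharply_transitive_on_planes \<Theta> \<longleftrightarrow>
     (\<forall>\<rho> \<in> \<Theta>. \<forall>D \<in> \<Psi>. \<rho> ` D \<in> \<Psi>) \<and>
     (\<forall>D1 \<in> \<Psi>. \<forall>D2 \<in> \<Psi>. \<exists>!\<rho>. \<rho> \<in> \<Theta> \<and> \<rho> ` D1 = D2)"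


section \<open>Loops\<close>

definition is_loop :: "'a set \<Rightarrow> ('a \<Rightarrow> 'a \<Rightarrow> 'a) \<Rightarrow> 'a \<Rightarrow> bool" where
  "is_loop L m e \<longleftrightarrow>
     (\<forall>x \<in> L. \<forall>y \<in> L. m x y \<in> L) \<and>
     e \<in> L \<and> (\<forall>x \<in> L. m e x = x \<and> m x e = x) \<and>
     (\<forall>a \<in> L. \<forall>b \<in> L. \<exists>!y. y \<in> L \<and> m a y = b) \<and>
     (\<forall>a \<in> L. \<forall>b \<in> L. \<exists>!x. x \<in> L \<and> m x a = b)"

text \<open>\<open>loop_ldiv L m a b\<close> is \<open>a \ b\<close> and \<open>loop_rdiv L m b a\<close> is \<open>b / a\<close>.\<close>

definition loop_ldiv :: "'a set \<Rightarrow> ('a \<Rightarrow> 'a \<Rightarrow> 'a) \<Rightarrow> 'a \<Rightarrow> 'a \<Rightarrow> 'a" where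
  "loop_ldiv L m a b = (THE y. y \<in> L \<and> m a y = b)"

definition loop_rdiv :: "'a set \<Rightarrow> ('a \<Rightarrow> 'a \<Rightarrow> 'a) \<Rightarrow> 'a \<Rightarrow> 'a \<Rightarrow> 'a" where
  "loop_rdiv L m b a = (THE x. x \<in> L \<and> m x a = b)"

definition left_translation :: "'a set \<Rightarrow> ('a \<Rightarrow> 'a \<Rightarrow> 'a) \<Rightarrow> 'a \<Rightarrow> ('a \<Rightarrow> 'a)" where
  "left_translation L m a = (\<lambda>y \<in> L. m a y)"

definition is_bol_loop :: "'a set \<Rightarrow> ('a \<Rightarrow> 'a \<Rightarrow> 'a) \<Rightarrow> 'a \<Rightarrow> bool" where
  "is_bol_loop L m e \<longleftrightarrow> is_loop L m e \<and>
     (\<forall>a \<in> L. \<forall>b \<in> L.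
        compose L (left_translation L m a)
          (compose L (left_translation L m b) (left_translation L m a))
        \<in> left_translation L m ` L)"

text \<open>\<open>Ck_on k U f\<close> is the \<open>C\<^sup>k\<close> property of \<open>f\<close> on an open set \<open>U\<close>.\<close>

primrec Ck_on ::
  "nat \<Rightarrow> 'a::real_normed_vector set \<Rightarrow> ('a \<Rightarrow> 'b::real_normed_vector) \<Rightarrow> bool" where
  "Ck_on 0 U f \<longleftrightarrow> continuous_on U f"
| "Ck_on (Suc k) U f \<longleftrightarrow>
     (\<forall>x \<in> U. f differentiable (at x)) \<and>
     (\<forall>v. Ck_on k U (\<lambda>x. frechet_derivative f (at x) v))"

definition smooth_on ::
  "'a::real_normed_vector set \<Rightarrow> ('a \<Rightarrow> 'b::real_normed_vector) \<Rightarrow> bool" where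
  "smooth_on U f \<longleftrightarrow> (\<forall>k. Ck_on k U f)"

text \<open>A map \<open>f: L \<times> L \<rightarrow> L\<close> is read in a global chart \<open>\<phi>\<close> of \<open>L\<close>.\<close>

definition smooth_binary_map ::
  "('a \<Rightarrow> 'v::euclidean_space) \<Rightarrow> 'a set \<Rightarrow> ('a \<Rightarrow> 'a \<Rightarrow> 'a) \<Rightarrow> bool" where
  "smooth_binary_map \<phi> L f \<longleftrightarrow>
     smooth_on (\<phi> ` L \<times> \<phi> ` L)
       (\<lambda>(u, v). \<phi> (f (inv_into L \<phi> u) (inv_into L \<phi> v)))"

text \<open>Differentiable loops on a manifold whose structure is given by one global chart; the
  dimension is that of the codomain of the chart.\<close>

definition differentiable_loop ::
  "('a \<Rightarrow> 'v::euclidean_space) \<Rightarrow> 'a set \<Rightarrow> ('a \<Rightarrow> 'a \<Rightarrow> 'a) \<Rightarrow> 'a \<Rightarrow> bool" where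
  "differentiable_loop \<phi> L m e \<longleftrightarrow>
     inj_on \<phi> L \<and> open (\<phi> ` L) \<and> is_loop L m e \<and>
     smooth_binary_map \<phi> L m \<and>
     smooth_binary_map \<phi> L (loop_rdiv L m) \<and>
     smooth_binary_map \<phi> L (loop_ldiv L m)"


section \<open>The loop on the manifold of euclidean planes\<close>

text \<open>The direction space of a euclidean plane does not contain the negative vector
  \<open>x = k = 0, l = 1\<close>, so such a plane has a unique equation \<open>l = a x + b k + c\<close>. The
  coefficients \<open>(a, b, c)\<close> are affine coordinates on the dual projective space; they
  give the manifold structure on the open set \<open>\<Psi>\<close> of planes.\<close>

definition plane_chart :: "(real^2^2) set \<Rightarrow> real^3" where
  "plane_chart D =
     (THE p. D = {Y \<in> E21. lco Y = p $ 1 * xco Y + p $ 2 * kco Y + p $ 3})"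

definition plane_mult ::
  "(real^2^2 \<Rightarrow> real^2^2) set \<Rightarrow> (real^2^2) set \<Rightarrow>
   (real^2^2) set \<Rightarrow> (real^2^2) set \<Rightarrow> (real^2^2) set" where
  "plane_mult \<Theta> P X Y = (THE \<rho>. \<rho> \<in> \<Theta> \<and> \<rho> ` P = X) ` Y"

definition plane_action ::
  "(real^2^2 \<Rightarrow> real^2^2) \<Rightarrow> ((real^2^2) set \<Rightarrow> (real^2^2) set)" where
  "plane_action g = (\<lambda>D \<in> \<Psi>. g ` D)"

text \<open>Left translations are permutations of \<open>\<Psi>\<close>, whereas the motion group consists of maps
  on \<open>E21\<close>. The motion group has to act faithfully on \<open>\<Psi>\<close>, its image has to contain the left
  translations, and the subgroup corresponding to the group generated by them has to be dense.\<close>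

definition left_translations_topologically_generate ::
  "((real^2^2) set \<Rightarrow> (real^2^2) set \<Rightarrow> (real^2^2) set) \<Rightarrow> bool" where
  "left_translations_topologically_generate m \<longleftrightarrow>
     inj_on plane_action motion_group \<and>
     left_translation \<Psi> m ` \<Psi> \<subseteq> plane_action ` motion_group \<and>
     motion_topology closure_of
       {g \<in> motion_group.
          plane_action g \<in> generate (BijGroup \<Psi>) (left_translation \<Psi> m ` \<Psi>)}
       = motion_group"

end

(* A euclidean plane l = a x + b k + c is a point (a, b) of the Klein disc, namely its timelike
   normal direction, together with the height c. The set Sigma consists of the boosts, which act
   sharply transitively on the disc: for symmetric positive definite Q1, Q2 of determinant 1, the
   equation B Q1 B = Q2 has exactly one symmetric positive definite solution B of determinant 1,
   the normalisation of Q1^(-1) + Q2. Translations along the transversal line S fix (a, b) and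
   are simply transitive on the heights. The resulting formulas for the three loop operations are
   algebraic, hence smooth. Theta even generates the motion group algebraically, because boosts
   generate SL2 and the orbit of the direction of S under SL2 spans the space. The Bol condition
   would force boosts to preserve the direction of S. *)

theory Submission
  imports Defs
begin

text \<open>In the coordinates (x, k, l), conjugation by a symmetric positive definite matrix of
  determinant 1 is a product of two reflections for the Lorentz form x^2 + k^2 - l^2: first l -> -l,
  then the reflection along a unit timelike vector w = (m1, m2, u), u = sqrt (1 + m1^2 + m2^2).
  Taking (m1, m2) as parameters removes the exponential and leaves formulas polynomial in m1, m2, u.
  It also explains the unique solution of the matrix equation: a boost carries one unit normal to
  another exactly if w is the normalised difference between the second normal and the mirror image
  of the first.

  With the translations this becomes a triangular system: the directions of two planes fix the
  boost, and then their heights fix the translation by a linear equation whose leading coefficient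
  is nonzero because S is transversal to the planes. The resulting equivalence
  \<open>theta_image_eq_iff\<close> is the source of sharp transitivity, of the unit laws and of
  right division.\<close>

section \<open>Calculus of \<open>C\<^sup>k\<close> maps\<close>

text \<open>Differentiability at a point sees a whole neighbourhood; agreement on U transfers
  because U is open.\<close>

lemma Ck_on_cong:
  fixes f g :: "'a::real_normed_vector \<Rightarrow> 'b::real_normed_vector"
  assumes "open U" "\<And>x. x \<in> U \<Longrightarrow> f x = g x" "Ck_on k U f"
  shows "Ck_on k U g"
  using assms(2,3)
proof (induction k arbitrary: f g)
  case 0
  then show ?case by (simp cong: continuous_on_cong)
next
  case (Suc k)
  have "(g has_derivative frechet_derivative f (at x)) (at x)" if "x \<in> U" for x
    using Suc.prems that assms(1)
    by (intro has_derivative_transform_within_open[of f _ x UNIV U g])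
       (auto simp: frechet_derivative_works)
  then have "frechet_derivative f (at x) = frechet_derivative g (at x)" "g differentiable (at x)"
    if "x \<in> U" for x
    using that frechet_derivative_at differentiableI by blast+
  then show ?case
    using Suc.IH[of "\<lambda>x. frechet_derivative f (at x) v" "\<lambda>x. frechet_derivative g (at x) v" for v]
      Suc.prems by auto
qed

text \<open>Lets an explicit derivative stand for \<open>frechet_derivative\<close>, so that the
  closure rules below follow the usual differentiation rules.\<close>

lemma Ck_on_SucI:
  fixes f :: "'a::real_normed_vector \<Rightarrow> 'b::real_normed_vector"
  assumes "open U" "\<And>x. x \<in> U \<Longrightarrow> (f has_derivative f' x) (at x)"
    and "\<And>v. Ck_on k U (\<lambda>x. f' x v)"
  shows "Ck_on (Suc k) U f"
proof -
  have "f' x = frechet_derivative f (at x)" if "x \<in> U" for x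
    using assms(2)[OF that] frechet_derivative_at by blast
  then have "Ck_on k U (\<lambda>x. frechet_derivative f (at x) v)" for v
    using Ck_on_cong[OF assms(1) _ assms(3)[of v]] by simp
  then show ?thesis
    using assms(2) by (auto simp: differentiable_def)
qed

lemma Ck_on_SucE:
  fixes f :: "'a::real_normed_vector \<Rightarrow> 'b::real_normed_vector"
  assumes "Ck_on (Suc k) U f"
  obtains f' where "\<And>x. x \<in> U \<Longrightarrow> (f has_derivative f' x) (at x)"
    and "\<And>v. Ck_on k U (\<lambda>x. f' x v)"
  using assms that[of "\<lambda>x. frechet_derivative f (at x)"] by (auto simp: frechet_derivative_works)

lemma Ck_on_SucD:
  fixes f :: "'a::real_normed_vector \<Rightarrow> 'b::real_normed_vector"
  shows "Ck_on (Suc k) U f \<Longrightarrow> Ck_on k U f"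
proof (induction k arbitrary: f)
  case 0
  then show ?case
    by (auto intro!: continuous_at_imp_continuous_on differentiable_imp_continuous_within)
next
  case (Suc k)
  then show ?case by (metis Ck_on.simps(2))
qed

lemma Ck_on_const: "open U \<Longrightarrow> Ck_on k U (\<lambda>x. c)"
proof (induction k arbitrary: c)
  case (Suc k)
  then show ?case by (intro Ck_on_SucI[where f' = "\<lambda>x v. 0"]) auto
qed simp

lemma Ck_on_bounded_linear:
  assumes "open U" "bounded_linear h"
  shows "Ck_on k U h"
proof (cases k)
  case 0
  then show ?thesis using assms by (simp add: linear_continuous_on)
next
  case (Suc j)
  then show ?thesis
    using assms Ck_on_const[OF assms(1)]
    by (auto intro!: Ck_on_SucI[where f' = "\<lambda>x. h"] bounded_linear_imp_has_derivative
        simp del: Ck_on.simps)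
qed

lemma Ck_on_linear_comp:
  fixes f :: "'a::real_normed_vector \<Rightarrow> 'b::real_normed_vector"
    and h :: "'b \<Rightarrow> 'c::real_normed_vector"
  assumes "open U" "bounded_linear h"
  shows "Ck_on k U f \<Longrightarrow> Ck_on k U (\<lambda>x. h (f x))"
proof (induction k arbitrary: f)
  case 0
  then show ?case
    using assms(2) by (auto intro: bounded_linear.continuous_on)
next
  case (Suc k)
  obtain f' where f': "\<And>x. x \<in> U \<Longrightarrow> (f has_derivative f' x) (at x)"
    "\<And>v. Ck_on k U (\<lambda>x. f' x v)"
    using Suc.prems by (rule Ck_on_SucE) blast
  show ?case
    using assms f' Suc.IH
    by (intro Ck_on_SucI[where f' = "\<lambda>x v. h (f' x v)"])
       (auto intro: bounded_linear.has_derivative simp del: Ck_on.simps)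
qed

lemma Ck_on_add:
  fixes f g :: "'a::real_normed_vector \<Rightarrow> 'b::real_normed_vector"
  assumes "open U"
  shows "Ck_on k U f \<Longrightarrow> Ck_on k U g \<Longrightarrow> Ck_on k U (\<lambda>x. f x + g x)"
proof (induction k arbitrary: f g)
  case 0
  then show ?case by (auto intro: continuous_on_add)
next
  case (Suc k)
  obtain f' where f': "\<And>x. x \<in> U \<Longrightarrow> (f has_derivative f' x) (at x)"
    "\<And>v. Ck_on k U (\<lambda>x. f' x v)"
    using Suc.prems(1) by (rule Ck_on_SucE) blast
  obtain g' where g': "\<And>x. x \<in> U \<Longrightarrow> (g has_derivative g' x) (at x)"
    "\<And>v. Ck_on k U (\<lambda>x. g' x v)"
    using Suc.prems(2) by (rule Ck_on_SucE) blast
  show ?case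
    using assms f' g' Suc.IH
    by (intro Ck_on_SucI[where f' = "\<lambda>x v. f' x v + g' x v"])
       (auto intro: has_derivative_add simp del: Ck_on.simps)
qed

text \<open>The product rule leaves f and g undifferentiated in the derivative;
  \<open>Ck_on_SucD\<close> supplies them at the lower order.\<close>

lemma Ck_on_mult:
  fixes f g :: "'a::real_normed_vector \<Rightarrow> real"
  assumes "open U"
  shows "Ck_on k U f \<Longrightarrow> Ck_on k U g \<Longrightarrow> Ck_on k U (\<lambda>x. f x * g x)"
proof (induction k arbitrary: f g)
  case 0
  then show ?case by (auto intro: continuous_on_mult)
next
  case (Suc k)
  obtain f' where f': "\<And>x. x \<in> U \<Longrightarrow> (f has_derivative f' x) (at x)"
    "\<And>v. Ck_on k U (\<lambda>x. f' x v)"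
    using Suc.prems(1) by (rule Ck_on_SucE) blast
  obtain g' where g': "\<And>x. x \<in> U \<Longrightarrow> (g has_derivative g' x) (at x)"
    "\<And>v. Ck_on k U (\<lambda>x. g' x v)"
    using Suc.prems(2) by (rule Ck_on_SucE) blast
  show ?case
    using assms f' g' Suc.IH Ck_on_SucD[OF Suc.prems(1)] Ck_on_SucD[OF Suc.prems(2)]
    by (intro Ck_on_SucI[where f' = "\<lambda>x v. f x * g' x v + f' x v * g x"] Ck_on_add)
       (auto intro: has_derivative_mult simp del: Ck_on.simps)
qed

text \<open>The derivative is a product of f' with copies of 1/f, for which the induction hypothesis
  is available; its sign is kept as a factor -1 so that \<open>Ck_on_mult\<close> applies.\<close>

lemma Ck_on_inverse:
  fixes f :: "'a::real_normed_vector \<Rightarrow> real"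
  assumes "open U" "\<And>x. x \<in> U \<Longrightarrow> f x \<noteq> 0"
  shows "Ck_on k U f \<Longrightarrow> Ck_on k U (\<lambda>x. inverse (f x))"
proof (induction k)
  case 0
  then show ?case using assms(2) by (auto intro: continuous_on_inverse)
next
  case (Suc k)
  obtain f' where f': "\<And>x. x \<in> U \<Longrightarrow> (f has_derivative f' x) (at x)"
    "\<And>v. Ck_on k U (\<lambda>x. f' x v)"
    using Suc.prems by (rule Ck_on_SucE) blast
  have "((\<lambda>x. inverse (f x)) has_derivative
      (\<lambda>v. (- 1) * (inverse (f x) * f' x v * inverse (f x)))) (at x)" if "x \<in> U" for x
    using Deriv.has_derivative_inverse[OF assms(2)[OF that] f'(1)[OF that]] by simp
  then show ?case
    using assms f' Suc.IH[OF Ck_on_SucD[OF Suc.prems]]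
    by (intro Ck_on_SucI[where f' = "\<lambda>x v. (- 1) * (inverse (f x) * f' x v * inverse (f x))"]
        Ck_on_mult Ck_on_const)
       (auto simp del: Ck_on.simps)
qed

lemma Ck_on_sqrt:
  fixes f :: "'a::real_normed_vector \<Rightarrow> real"
  assumes "open U" "\<And>x. x \<in> U \<Longrightarrow> f x > 0"
  shows "Ck_on k U f \<Longrightarrow> Ck_on k U (\<lambda>x. sqrt (f x))"
proof (induction k)
  case 0
  then show ?case by (auto intro: continuous_on_real_sqrt)
next
  case (Suc k)
  obtain f' where f': "\<And>x. x \<in> U \<Longrightarrow> (f has_derivative f' x) (at x)"
    "\<And>v. Ck_on k U (\<lambda>x. f' x v)"
    using Suc.prems by (rule Ck_on_SucE) blast
  have "((\<lambda>x. sqrt (f x)) has_derivative (\<lambda>v. f' x v * (inverse (sqrt (f x)) * (1/2)))) (at x)"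
    if "x \<in> U" for x
    using has_derivative_real_sqrt[OF assms(2)[OF that] f'(1)[OF that]]
    by (simp add: field_simps)
  moreover have "Ck_on k U (\<lambda>x. inverse (sqrt (f x)))"
    using assms Suc.IH[OF Ck_on_SucD[OF Suc.prems]]
    by (intro Ck_on_inverse) (auto simp: less_imp_neq[symmetric] dest!: assms(2))
  ultimately show ?case
    using assms(1) f'
    by (intro Ck_on_SucI[where f' = "\<lambda>x v. f' x v * (inverse (sqrt (f x)) * (1/2))"]
        Ck_on_mult Ck_on_const) (auto simp del: Ck_on.simps)
qed

lemma Ck_on_sum:
  fixes f :: "'i \<Rightarrow> 'a::real_normed_vector \<Rightarrow> 'b::real_normed_vector"
  assumes "open U"
  shows "(\<And>i. i \<in> I \<Longrightarrow> Ck_on k U (f i)) \<Longrightarrow> Ck_on k U (\<lambda>x. \<Sum>i\<in>I. f i x)"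
  by (induction I rule: infinite_finite_induct)
     (auto intro!: Ck_on_const Ck_on_add assms simp del: Ck_on.simps)

section \<open>Closure rules for smooth maps\<close>

named_theorems smooth_intros

lemma smooth_on_const [smooth_intros]: "open U \<Longrightarrow> smooth_on U (\<lambda>x. c)"
  by (simp add: smooth_on_def Ck_on_const)

lemma smooth_on_bounded_linear: "open U \<Longrightarrow> bounded_linear h \<Longrightarrow> smooth_on U h"
  by (simp add: smooth_on_def Ck_on_bounded_linear)

lemma smooth_on_nth [smooth_intros]:
  fixes f :: "'a::real_normed_vector \<Rightarrow> real^'n"
  shows "open U \<Longrightarrow> smooth_on U f \<Longrightarrow> smooth_on U (\<lambda>x. f x $ i)"
  by (simp add: smooth_on_def Ck_on_linear_comp[OF _ bounded_linear_vec_nth])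

lemma smooth_on_add [smooth_intros]:
  "open U \<Longrightarrow> smooth_on U f \<Longrightarrow> smooth_on U g \<Longrightarrow> smooth_on U (\<lambda>x. f x + g x)"
  by (simp add: smooth_on_def Ck_on_add)

lemma smooth_on_mult [smooth_intros]:
  fixes f g :: "'a::real_normed_vector \<Rightarrow> real"
  shows "open U \<Longrightarrow> smooth_on U f \<Longrightarrow> smooth_on U g \<Longrightarrow> smooth_on U (\<lambda>x. f x * g x)"
  by (simp add: smooth_on_def Ck_on_mult)

lemma smooth_on_minus [smooth_intros]:
  "open U \<Longrightarrow> smooth_on U f \<Longrightarrow> smooth_on U (\<lambda>x. - f x)"
  by (simp add: smooth_on_def Ck_on_linear_comp[OF _ bounded_linear_minus[OF bounded_linear_ident]])

lemma smooth_on_diff [smooth_intros]: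
  "open U \<Longrightarrow> smooth_on U f \<Longrightarrow> smooth_on U g \<Longrightarrow> smooth_on U (\<lambda>x. f x - g x)"
  using smooth_on_add[of U f "\<lambda>x. - g x"] smooth_on_minus[of U g] by simp

lemma smooth_on_power2 [smooth_intros]:
  fixes f :: "'a::real_normed_vector \<Rightarrow> real"
  shows "open U \<Longrightarrow> smooth_on U f \<Longrightarrow> smooth_on U (\<lambda>x. (f x)\<^sup>2)"
  unfolding power2_eq_square by (rule smooth_on_mult)

lemma smooth_on_divide [smooth_intros]:
  fixes f g :: "'a::real_normed_vector \<Rightarrow> real"
  shows "open U \<Longrightarrow> smooth_on U f \<Longrightarrow> smooth_on U g \<Longrightarrow> (\<And>x. x \<in> U \<Longrightarrow> g x \<noteq> 0) \<Longrightarrow>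
    smooth_on U (\<lambda>x. f x / g x)"
  unfolding divide_inverse smooth_on_def by (auto intro!: Ck_on_mult Ck_on_inverse)

lemma smooth_on_sqrt [smooth_intros]:
  fixes f :: "'a::real_normed_vector \<Rightarrow> real"
  shows "open U \<Longrightarrow> smooth_on U f \<Longrightarrow> (\<And>x. x \<in> U \<Longrightarrow> f x > 0) \<Longrightarrow> smooth_on U (\<lambda>x. sqrt (f x))"
  unfolding smooth_on_def by (auto intro!: Ck_on_sqrt)

lemma smooth_on_cong:
  "open U \<Longrightarrow> (\<And>x. x \<in> U \<Longrightarrow> f x = g x) \<Longrightarrow> smooth_on U f \<Longrightarrow> smooth_on U g"
  unfolding smooth_on_def using Ck_on_cong by blast

lemma smooth_on_vec:
  fixes f :: "'a::real_normed_vector \<Rightarrow> real^'n"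
  assumes "open U" "\<And>i. smooth_on U (\<lambda>x. f x $ i)"
  shows "smooth_on U f"
  unfolding smooth_on_def
proof
  fix k
  have "Ck_on k U (\<lambda>x. \<Sum>i\<in>UNIV. (f x $ i) *\<^sub>R axis i (1::real))"
    using assms
    by (intro Ck_on_sum Ck_on_linear_comp[where h = "\<lambda>r. r *\<^sub>R c" for c]
        bounded_linear_scaleR_left) (auto simp: smooth_on_def)
  then show "Ck_on k U f"
    by (rule Ck_on_cong[OF assms(1), rotated])
       (simp add: vec_eq_iff axis_def if_distrib[of "\<lambda>t. _ * t"] cong: if_cong)
qed

section \<open>Coordinates\<close>

definition mk :: "real \<Rightarrow> real \<Rightarrow> real \<Rightarrow> real^2^2" where
  "mk x k l = vector [vector [x, k + l], vector [k - l, - x]]"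

lemma mat22_eq_iff:
  fixes A B :: "real^2^2"
  shows "A = B \<longleftrightarrow> A$1$1 = B$1$1 \<and> A$1$2 = B$1$2 \<and> A$2$1 = B$2$1 \<and> A$2$2 = B$2$2"
  by (auto simp: vec_eq_iff forall_2)

lemma mk_nth [simp]:
  "mk x k l $ 1 $ 1 = x" "mk x k l $ 1 $ 2 = k + l" "mk x k l $ 2 $ 1 = k - l" "mk x k l $ 2 $ 2 = - x"
  by (simp_all add: mk_def)

lemma mk_co [simp]: "xco (mk x k l) = x" "kco (mk x k l) = k" "lco (mk x k l) = l"
  by (simp_all add: xco_def kco_def lco_def)

lemma mk_in_E21 [simp]: "mk x k l \<in> E21"
  by (simp add: E21_def trace_def sum_2)

lemma mk_of_co: "Y \<in> E21 \<Longrightarrow> mk (xco Y) (kco Y) (lco Y) = Y"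
  by (simp add: E21_def trace_def sum_2 mat22_eq_iff xco_def kco_def lco_def field_simps)

lemma in_E21E:
  assumes "Y \<in> E21" obtains x k l where "Y = mk x k l"
  using mk_of_co[OF assms] by metis

lemma E21_set_eqI:
  assumes "A \<subseteq> E21" "B \<subseteq> E21" "\<And>x k l. mk x k l \<in> A \<longleftrightarrow> mk x k l \<in> B"
  shows "A = B"
  using assms by (metis in_E21E subset_eq subset_antisym)

lemma mk_eq_iff [simp]: "mk x k l = mk x' k' l' \<longleftrightarrow> x = x' \<and> k = k' \<and> l = l'"
  by (metis mk_co)

lemma mk_add [simp]: "mk x k l + mk x' k' l' = mk (x + x') (k + k') (l + l')"
  by (simp add: mat22_eq_iff)

lemma mk_diff [simp]: "mk x k l - mk x' k' l' = mk (x - x') (k - k') (l - l')"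
  by (simp add: mat22_eq_iff)

lemma mk_scaleR [simp]: "r *\<^sub>R mk x k l = mk (r * x) (r * k) (r * l)"
  by (simp add: mat22_eq_iff algebra_simps)

lemma mk_0 [simp]: "mk 0 0 0 = 0"
  by (simp add: mat22_eq_iff)

lemma mk_eq_0 [simp]: "mk x k l = 0 \<longleftrightarrow> x = 0 \<and> k = 0 \<and> l = 0"
  by (metis mk_0 mk_eq_iff)

lemma co_linear:
  "linear xco" "linear kco" "linear lco"
  by (auto intro!: linearI simp: xco_def kco_def lco_def algebra_simps add_divide_distrib
      diff_divide_distrib)

lemma subspace_E21: "subspace E21"
proof -
  have "x + y + (x' + y') = 0" if "x + x' = 0" "y + y' = 0" for x y x' y' :: real
    using that by linarith
  moreover have "c * x + c * x' = 0" if "x + x' = 0" for c x x' :: real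
    using that by (simp flip: distrib_left)
  ultimately show ?thesis by (auto simp: subspace_def E21_def trace_def sum_2)
qed

lemma pnorm_mk: "pnorm (mk x k l) = x\<^sup>2 + k\<^sup>2 - l\<^sup>2"
  by (simp add: pnorm_def)

text \<open>Makes the norm visibly invariant under conjugation, as used in
  \<open>pnorm_cj\<close>.\<close>

lemma pnorm_eq_det: "Y \<in> E21 \<Longrightarrow> pnorm Y = - det Y"
  by (auto elim!: in_E21E simp: pnorm_mk det_2 power2_eq_square algebra_simps)

section \<open>Equations of euclidean planes\<close>

definition plane_of :: "real^3 \<Rightarrow> (real^2^2) set" where
  "plane_of p = {Y \<in> E21. lco Y = p$1 * xco Y + p$2 * kco Y + p$3}"

definition chart_domain :: "(real^3) set" where
  "chart_domain = {p. (p$1)\<^sup>2 + (p$2)\<^sup>2 < 1}"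

lemma open_chart_domain: "open chart_domain"
  unfolding chart_domain_def by (intro open_Collect_less continuous_intros)

lemma in_plane_of: "mk x k l \<in> plane_of p \<longleftrightarrow> l = p$1 * x + p$2 * k + p$3"
  by (simp add: plane_of_def)

lemma vec3_eq_iff: "(p::real^3) = q \<longleftrightarrow> p$1 = q$1 \<and> p$2 = q$2 \<and> p$3 = q$3"
  by (auto simp: vec_eq_iff forall_3)

lemma inj_plane_of: "inj plane_of"
proof (rule injI)
  fix p q assume eq: "plane_of p = plane_of q"
  have "l = p$1 * x + p$2 * k + p$3 \<longleftrightarrow> l = q$1 * x + q$2 * k + q$3" for x k l
    using eq in_plane_of by metis
  from this[of "p$3" 0 0] this[of "p$1 + p$3" 1 0] this[of "p$2 + p$3" 0 1]
  show "p = q" by (simp add: vec3_eq_iff)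
qed

lemma plane_chart_plane_of [simp]: "plane_chart (plane_of p) = p"
  unfolding plane_chart_def plane_of_def[symmetric]
  using inj_plane_of by (auto simp: inj_eq)

lemma plane_of_subset: "plane_of p \<subseteq> E21"
  by (auto simp: plane_of_def)

lemma plane_of_eq_image:
  "plane_of p = (+) (mk 0 0 (p$3)) ` (\<lambda>z. mk (fst z) (snd z) (p$1 * fst z + p$2 * snd z)) ` UNIV"
  by (rule E21_set_eqI) (auto simp: plane_of_subset in_plane_of image_iff)

lemma plane_of_in_Psi:
  assumes "p \<in> chart_domain"
  shows "plane_of p \<in> \<Psi>"
proof -
  let ?f = "\<lambda>z. mk (fst z) (snd z) (p$1 * fst z + p$2 * snd z)"
  have lin: "linear ?f"
    by (auto intro!: linearI simp: algebra_simps)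
  have "inj ?f" by (auto simp: inj_def prod_eq_iff)
  then have "aff_dim (plane_of p) = 2"
    unfolding plane_of_eq_image using lin by (simp add: aff_dim_translation_eq)
  moreover have "affine (plane_of p)"
    unfolding plane_of_eq_image affine_translation[symmetric]
    using linear_subspace_image[OF lin subspace_UNIV] by (rule subspace_imp_affine)
  moreover have "pnorm V > 0" if V: "V \<in> direction_space (plane_of p)" "V \<noteq> 0" for V
  proof -
    obtain x k where V_eq: "V = mk x k (p$1 * x + p$2 * k)"
    proof -
      obtain Y Z where YZ: "Y \<in> plane_of p" "Z \<in> plane_of p" "V = Y - Z"
        using V(1) by (auto simp: direction_space_def)
      obtain x k l where Y: "Y = mk x k l" using YZ(1) plane_of_subset by (blast elim: in_E21E)
      obtain x' k' l' where Z: "Z = mk x' k' l'" using YZ(2) plane_of_subset by (blast elim: in_E21E)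
      show ?thesis
        using that[of "x - x'" "k - k'"] YZ by (simp add: Y Z in_plane_of algebra_simps)
    qed
    have "(p$1 * x + p$2 * k)\<^sup>2 \<le> ((p$1)\<^sup>2 + (p$2)\<^sup>2) * (x\<^sup>2 + k\<^sup>2)"
      \<comment> \<open>Cauchy-Schwarz through Lagrange's identity: the square inserted here is the
        difference of the two sides.\<close>
      using zero_le_power2[of "p$1 * k - p$2 * x"] by (simp add: power2_eq_square algebra_simps)
    also have "\<dots> < 1 * (x\<^sup>2 + k\<^sup>2)"
      using assms V(2) V_eq
      by (intro mult_strict_right_mono) (auto simp: chart_domain_def sum_power2_gt_zero_iff)
    finally show ?thesis by (simp add: V_eq pnorm_mk)
  qed
  ultimately show ?thesis by (simp add: euclidean_planes_def is_plane_def plane_of_subset)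
qed

text \<open>Positivity keeps the direction space off the l-axis, so it is the graph of a linear form
  over the (x, k)-plane; the preimages e1, e2 of the unit vectors give its slopes.\<close>

lemma Psi_plane_of:
  assumes "D \<in> \<Psi>"
  obtains p where "p \<in> chart_domain" "D = plane_of p"
proof -
  have D: "D \<subseteq> E21" "affine D" "aff_dim D = 2"
    and pos: "\<And>V. V \<in> direction_space D \<Longrightarrow> V \<noteq> 0 \<Longrightarrow> pnorm V > 0"
    using assms by (auto simp: euclidean_planes_def is_plane_def)
  have "D \<noteq> {}" using D(3) by auto
  then obtain Y0 where Y0: "Y0 \<in> D" by auto
  define V where "V = (\<lambda>Y. Y - Y0) ` D"
  have V: "subspace V" unfolding V_def by (rule affine_diffs_subspace_subtract[OF D(2) Y0])
  have "aff_dim V = 2" unfolding V_def by (simp add: aff_dim_translation_eq_subtract D(3))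
  then have dimV: "dim V = 2" using aff_dim_subspace[OF V] by simp
  have D_iff: "Y \<in> D \<longleftrightarrow> Y - Y0 \<in> V" for Y
    by (auto simp: V_def image_iff)
  have VE: "V \<subseteq> E21"
    using D(1) Y0 subspace_diff[OF subspace_E21] by (auto simp: V_def)
  have posV: "pnorm X > 0" if "X \<in> V" "X \<noteq> 0" for X
    using that Y0 pos[of X] by (auto simp: V_def direction_space_def)
  let ?\<pi> = "\<lambda>Y. (xco Y, kco Y)"
  have lin: "linear ?\<pi>"
    using co_linear by (auto intro!: linearI simp: linear_add linear_scale)
  have ker: "X = 0" if "X \<in> V" "xco X = 0" "kco X = 0" for X
    using posV[OF that(1)] that by (force simp: pnorm_def)
  have "inj_on ?\<pi> V"
    using lin V ker by (subst linear_inj_on_iff_eq_0) (auto simp: zero_prod_def)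
  then have "dim (?\<pi> ` V) = 2"
    using dim_image_eq[OF lin, of V] V dimV by (simp add: span_eq_iff[THEN iffD2])
  then have "?\<pi> ` V = UNIV"
    using linear_subspace_image[OF lin V] dim_eq_full[of "?\<pi> ` V"]
    by (simp add: span_eq_iff[THEN iffD2])
  then have "(1, 0) \<in> ?\<pi> ` V" "(0, 1) \<in> ?\<pi> ` V" by simp_all
  then obtain e1 e2 where e: "e1 \<in> V" "xco e1 = 1" "kco e1 = 0" "e2 \<in> V" "xco e2 = 0" "kco e2 = 1"
    by auto
  define a b where "a = lco e1" and "b = lco e2"
  have e1: "e1 = mk 1 0 a" and e2: "e2 = mk 0 1 b"
    using e VE mk_of_co[of e1] mk_of_co[of e2] by (auto simp: a_def b_def)
  have in_V: "mk x k (a * x + b * k) \<in> V" for x k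
    using subspace_add[OF V subspace_scale[OF V e(1), of x] subspace_scale[OF V e(4), of k]]
    by (simp add: e1 e2 algebra_simps)
  have V_iff: "mk x k l \<in> V \<longleftrightarrow> l = a * x + b * k" for x k l
  proof
    assume "mk x k l \<in> V"
    then have "mk 0 0 (l - (a * x + b * k)) \<in> V"
      using subspace_diff[OF V _ in_V[of x k]] by fastforce
    then show "l = a * x + b * k" using ker by fastforce
  qed (use in_V in auto)
  obtain x0 k0 l0 where Y0_eq: "Y0 = mk x0 k0 l0" using Y0 D(1) by (blast elim: in_E21E)
  define p :: "real^3" where "p = vector [a, b, l0 - a * x0 - b * k0]"
  have "mk x k l \<in> D \<longleftrightarrow> mk x k l \<in> plane_of p" for x k l
    by (auto simp: D_iff V_iff Y0_eq in_plane_of p_def algebra_simps)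
  then have "D = plane_of p"
    by (rule E21_set_eqI[OF D(1) plane_of_subset])
  moreover have "a\<^sup>2 + b\<^sup>2 < 1"
  proof (rule ccontr)
    assume "\<not> a\<^sup>2 + b\<^sup>2 < 1"
    then have ge: "a\<^sup>2 + b\<^sup>2 \<ge> 1" by simp
    then have "a\<^sup>2 + b\<^sup>2 > (a\<^sup>2 + b\<^sup>2)\<^sup>2"
    proof -
      \<comment> \<open>The steepest direction: with s = a^2 + b^2 its norm is s - s^2, which cannot
        be positive when s is at least 1.\<close>
      have "mk a b (a * a + b * b) \<noteq> 0" using ge by auto
      from posV[OF in_V this] show ?thesis by (simp add: pnorm_mk power2_eq_square)
    qed
    moreover have "(a\<^sup>2 + b\<^sup>2) * 1 \<le> (a\<^sup>2 + b\<^sup>2)\<^sup>2"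
      unfolding power2_eq_square[of "a\<^sup>2 + b\<^sup>2"] using ge by (intro mult_left_mono) auto
    ultimately show False by simp
  qed
  ultimately show ?thesis
    using that[of p] by (simp add: p_def chart_domain_def)
qed

lemma Psi_eq: "\<Psi> = plane_of ` chart_domain"
  using plane_of_in_Psi Psi_plane_of by blast

lemma plane_chart_Psi: "plane_chart ` \<Psi> = chart_domain"
  by (simp add: Psi_eq image_image)

lemma inj_on_plane_chart: "inj_on plane_chart \<Psi>"
  by (auto simp: Psi_eq inj_on_def)

lemma inv_into_plane_chart: "p \<in> chart_domain \<Longrightarrow> inv_into \<Psi> plane_chart p = plane_of p"
  by (metis inj_on_plane_chart inv_into_f_f plane_chart_plane_of plane_of_in_Psi)

section \<open>Motions\<close>

definition adj2 :: "real^2^2 \<Rightarrow> real^2^2" where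
  "adj2 A = vector [vector [A$2$2, - A$1$2], vector [- A$2$1, A$1$1]]"

lemma adj2_nth [simp]:
  "adj2 A $ 1 $ 1 = A$2$2" "adj2 A $ 1 $ 2 = - A$1$2"
  "adj2 A $ 2 $ 1 = - A$2$1" "adj2 A $ 2 $ 2 = A$1$1"
  by (simp_all add: adj2_def)

lemma mat22_mult_nth: "((A::real^2^2) ** B) $ i $ j = A$i$1 * B$1$j + A$i$2 * B$2$j"
  by (simp add: matrix_matrix_mult_def sum_2)

lemma mat1_nth [simp]:
  "(mat 1 :: real^2^2) $ 1 $ 1 = 1" "(mat 1 :: real^2^2) $ 1 $ 2 = 0"
  "(mat 1 :: real^2^2) $ 2 $ 1 = 0" "(mat 1 :: real^2^2) $ 2 $ 2 = 1"
  by (simp_all add: mat_def)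

lemma adj2_mult_self:
  assumes "A \<in> SL2"
  shows "A ** adj2 A = mat 1" "adj2 A ** A = mat 1"
  using assms by (simp_all add: mat22_eq_iff mat22_mult_nth SL2_def det_2 algebra_simps)

lemma matrix_inv_SL2:
  assumes "A \<in> SL2"
  shows "matrix_inv A = adj2 A"
proof -
  have "\<exists>B. A ** B = mat 1 \<and> B ** A = mat 1"
    using adj2_mult_self[OF assms] by blast
  from someI_ex[OF this] have "A ** matrix_inv A = mat 1"
    unfolding matrix_inv_def by simp
  then have "adj2 A ** (A ** matrix_inv A) = adj2 A"
    by simp
  then show ?thesis
    by (simp add: matrix_mul_assoc adj2_mult_self(2)[OF assms])
qed

lemma mat1_in_SL2 [simp]: "mat 1 \<in> SL2"
  by (simp add: SL2_def)

lemma adj2_in_SL2: "A \<in> SL2 \<Longrightarrow> adj2 A \<in> SL2"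
  by (simp add: SL2_def det_2 algebra_simps)

lemma mult_in_SL2: "A \<in> SL2 \<Longrightarrow> B \<in> SL2 \<Longrightarrow> A ** B \<in> SL2"
  by (simp add: SL2_def det_mul)

lemma adj2_mult: "adj2 (A ** B) = adj2 B ** adj2 A"
  by (simp add: mat22_eq_iff mat22_mult_nth algebra_simps)

text \<open>Conjugation by A when A lies in \<open>SL2\<close>. Written with the adjugate it is
  polynomial in A, so linearity and invariance of \<open>E21\<close> are plain identities.\<close>

definition cj :: "real^2^2 \<Rightarrow> real^2^2 \<Rightarrow> real^2^2" where
  "cj A Y = adj2 A ** Y ** A"

lemma cj_in_E21 [simp]: "Y \<in> E21 \<Longrightarrow> cj A Y \<in> E21"
proof -
  have "trace (cj A Y) = det A * trace Y"
    by (simp add: cj_def trace_def sum_2 mat22_mult_nth det_2 algebra_simps)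
  then show "Y \<in> E21 \<Longrightarrow> cj A Y \<in> E21" by (simp add: E21_def)
qed

lemma cj_mult: "cj A (cj B Y) = cj (B ** A) Y"
  by (simp add: cj_def adj2_mult matrix_mul_assoc)

lemma cj_mat1 [simp]: "cj (mat 1) Y = Y"
  by (simp add: cj_def mat22_eq_iff mat22_mult_nth)

lemma cj_add: "cj A (X + Y) = cj A X + cj A Y"
  by (simp add: cj_def mat22_eq_iff mat22_mult_nth algebra_simps)

lemma cj_scaleR: "cj A (r *\<^sub>R Y) = r *\<^sub>R cj A Y"
  by (simp add: cj_def mat22_eq_iff mat22_mult_nth algebra_simps)

lemma linear_cj: "linear (cj A)"
  by (simp add: linearI cj_add cj_scaleR)

lemma cj_cj_adj2 [simp]:
  assumes "A \<in> SL2"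
  shows "cj A (cj (adj2 A) Y) = Y" "cj (adj2 A) (cj A Y) = Y"
  by (simp_all add: cj_mult adj2_mult_self assms)

lemma motion_apply: "A \<in> SL2 \<Longrightarrow> Y \<in> E21 \<Longrightarrow> motion A X Y = cj A Y + X"
  by (simp add: motion_def matrix_inv_SL2 cj_def)

lemma motion_extensional: "motion A X \<in> extensional E21"
  by (simp add: motion_def)

lemma motion_in_E21:
  "A \<in> SL2 \<Longrightarrow> X \<in> E21 \<Longrightarrow> Y \<in> E21 \<Longrightarrow> motion A X Y \<in> E21"
  by (simp add: motion_apply subspace_add subspace_E21)

text \<open>Conjugation with the inverse on the left is a right action, hence the reversed product
  \<open>B ** A\<close>.\<close>

lemma compose_motion:
  assumes "A \<in> SL2" "B \<in> SL2" "Z \<in> E21"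
  shows "compose E21 (motion A X) (motion B Z) = motion (B ** A) (cj A Z + X)"
proof (rule extensionalityI[of _ E21])
  fix Y assume "Y \<in> E21"
  then show "compose E21 (motion A X) (motion B Z) Y = motion (B ** A) (cj A Z + X) Y"
    using assms
    by (simp add: compose_eq motion_apply motion_in_E21 mult_in_SL2 cj_add cj_mult[symmetric]
        subspace_add subspace_E21)
qed (simp_all add: motion_extensional)

lemma motion_id: "motion (mat 1) 0 = (\<lambda>Y\<in>E21. Y)"
  by (rule extensionalityI[of _ E21]) (simp_all add: motion_extensional motion_apply)

lemma zero_in_E21 [simp]: "0 \<in> E21"
  using mk_in_E21[of 0 0 0] by simp

lemma uminus_E21 [simp]: "X \<in> E21 \<Longrightarrow> - X \<in> E21"
  by (simp add: subspace_neg subspace_E21)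

lemma bij_betw_motion:
  assumes "A \<in> SL2" "X \<in> E21"
  shows "bij_betw (motion A X) E21 E21"
proof (rule bij_betw_byWitness[where f' = "motion (adj2 A) (- cj (adj2 A) X)"])
  show "\<forall>Y\<in>E21. motion (adj2 A) (- cj (adj2 A) X) (motion A X Y) = Y"
    using assms by (simp add: motion_apply motion_in_E21 adj2_in_SL2 cj_add subspace_add subspace_E21)
  show "\<forall>Y\<in>E21. motion A X (motion (adj2 A) (- cj (adj2 A) X) Y) = Y"
    using assms
    by (simp add: motion_apply adj2_in_SL2 cj_add subspace_diff subspace_E21
        linear_diff[OF linear_cj])
qed (use assms in \<open>auto simp: motion_in_E21 adj2_in_SL2\<close>)

lemma motion_group_compose:
  assumes "g \<in> motion_group" "h \<in> motion_group"
  shows "compose E21 g h \<in> motion_group"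
proof -
  obtain A X B Z where "A \<in> SL2" "X \<in> E21" "g = motion A X" "B \<in> SL2" "Z \<in> E21" "h = motion B Z"
    using assms by (auto simp: motion_group_def)
  moreover from this have "cj A Z + X \<in> E21" by (simp add: subspace_add subspace_E21)
  ultimately show ?thesis
    using compose_motion[of A B Z X] mult_in_SL2[of B A] by (auto simp: motion_group_def)
qed

lemma pnorm_cj: "A \<in> SL2 \<Longrightarrow> Y \<in> E21 \<Longrightarrow> pnorm (cj A Y) = pnorm Y"
  using adj2_in_SL2[of A] by (simp add: pnorm_eq_det) (simp add: cj_def det_mul SL2_def)

lemma motion_Psi:
  assumes A: "A \<in> SL2" and X: "X \<in> E21" and D: "D \<in> \<Psi>"
  shows "motion A X ` D \<in> \<Psi>"
proof -
  have DE: "D \<subseteq> E21" and aff: "affine D" "aff_dim D = 2"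
    and pos: "\<And>V. V \<in> direction_space D \<Longrightarrow> V \<noteq> 0 \<Longrightarrow> pnorm V > 0"
    using D by (auto simp: euclidean_planes_def is_plane_def)
  have eq: "motion A X ` D = (+) X ` cj A ` D"
    using DE A by (auto simp: image_image motion_apply add.commute intro!: image_cong)
  have inj: "inj (cj A)" by (metis A cj_cj_adj2(2) injI)
  have "affine (motion A X ` D)" unfolding eq affine_translation[symmetric]
    using affine_hull_linear_image[of "cj A" D] linear_cj[of A] aff(1)
    by (metis affine_affine_hull affine_hull_eq linear_conv_bounded_linear)
  moreover have "aff_dim (motion A X ` D) = 2"
    unfolding eq by (simp add: aff_dim_translation_eq linear_cj inj aff)
  moreover have "motion A X ` D \<subseteq> E21" using DE A X by (auto simp: motion_in_E21)
  moreover have "pnorm V > 0" if V: "V \<in> direction_space (motion A X ` D)" "V \<noteq> 0" for V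
  proof -
    obtain Y Z where YZ: "Y \<in> D" "Z \<in> D" "V = cj A Y - cj A Z"
      using V(1) unfolding eq direction_space_def by auto
    then have V_eq: "V = cj A (Y - Z)" by (simp add: linear_diff[OF linear_cj])
    have "Y - Z \<noteq> 0" using V(2) V_eq linear_0[OF linear_cj] by metis
    moreover have "Y - Z \<in> direction_space D" using YZ by (auto simp: direction_space_def)
    moreover have "Y - Z \<in> E21" using YZ DE subspace_diff[OF subspace_E21] by blast
    ultimately show ?thesis using pos pnorm_cj[OF A] V_eq by metis
  qed
  ultimately show ?thesis by (simp add: euclidean_planes_def is_plane_def)
qed

section \<open>Boosts\<close>

definition bu :: "real \<Rightarrow> real \<Rightarrow> real" where
  "bu m1 m2 = sqrt (1 + m1\<^sup>2 + m2\<^sup>2)"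

text \<open>The symmetric positive definite matrices of determinant 1, parametrised by the upper
  sheet u^2 - m1^2 - m2^2 = 1. The signs are chosen so that (m1, m2, u) is the reflection vector in
  \<open>cj_bmat\<close>.\<close>

definition bmat :: "real \<Rightarrow> real \<Rightarrow> real^2^2" where
  "bmat m1 m2 = vector [vector [bu m1 m2 - m2, m1], vector [m1, bu m1 m2 + m2]]"

lemma bu_pos [simp]: "bu m1 m2 > 0"
  by (simp add: bu_def add_pos_nonneg)

lemma bu_sq: "(bu m1 m2)\<^sup>2 = 1 + m1\<^sup>2 + m2\<^sup>2"
  by (simp add: bu_def)

lemma bu_unique: "u > 0 \<Longrightarrow> u\<^sup>2 = 1 + m1\<^sup>2 + m2\<^sup>2 \<Longrightarrow> bu m1 m2 = u"
  by (metis bu_def less_imp_le real_sqrt_unique)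

lemma bu_minus [simp]: "bu (- m1) (- m2) = bu m1 m2"
  by (simp add: bu_def)

lemma bmat_nth [simp]:
  "bmat m1 m2 $ 1 $ 1 = bu m1 m2 - m2" "bmat m1 m2 $ 1 $ 2 = m1"
  "bmat m1 m2 $ 2 $ 1 = m1" "bmat m1 m2 $ 2 $ 2 = bu m1 m2 + m2"
  by (simp_all add: bmat_def)

lemma bmat_in_SL2 [simp]: "bmat m1 m2 \<in> SL2"
  using bu_sq[of m1 m2] by (simp add: SL2_def det_2 power2_eq_square algebra_simps)

lemma adj2_bmat: "adj2 (bmat m1 m2) = bmat (- m1) (- m2)"
  by (simp add: mat22_eq_iff)

lemma bmat_0: "bmat 0 0 = mat 1"
  by (simp add: mat22_eq_iff bu_def)

lemma sym_SL2_eq_bmat: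
  assumes "A \<in> SL2" "A$1$2 = A$2$1" "A$1$1 + A$2$2 > 0"
  shows "A = bmat (A$1$2) ((A$2$2 - A$1$1) / 2)"
proof -
  have "bu (A$1$2) ((A$2$2 - A$1$1) / 2) = (A$1$1 + A$2$2) / 2"
    using assms by (intro bu_unique) (auto simp: SL2_def det_2 power2_eq_square field_simps)
  then show ?thesis using assms by (simp add: mat22_eq_iff field_simps)
qed

text \<open>The reflection l -> -l followed by the reflection along the unit timelike vector (m1,
  m2, u); s is the Lorentz product of (x, k, -l) with that vector.\<close>

lemma cj_bmat:
  "cj (bmat m1 m2) (mk x k l) =
    (let s = m1 * x + m2 * k + bu m1 m2 * l
     in mk (x + 2 * s * m1) (k + 2 * s * m2) (2 * bu m1 m2 * s - l))"
proof -
  have u: "bu m1 m2 * bu m1 m2 = 1 + m1 * m1 + m2 * m2"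
    using bu_sq[of m1 m2] by (simp add: power2_eq_square)
  have u': "bu m1 m2 * (bu m1 m2 * r) = r + m1 * m1 * r + m2 * m2 * r" for r
    unfolding mult.assoc[symmetric] u by (simp add: algebra_simps)
  show ?thesis
    by (simp add: Let_def cj_def mat22_eq_iff mat22_mult_nth algebra_simps u u')
qed

section \<open>The exponential image of the symmetric trace-zero matrices\<close>

lemma span_matH_matT: "span {matH, matT} = {mk h t 0 | h t. True}"
proof -
  have "matH = mk 1 0 0" "matT = mk 0 1 0"
    by (simp_all add: mat22_eq_iff matH_def matT_def)
  moreover have "A \<in> span {mk 1 0 0, mk 0 1 0} \<longleftrightarrow> (\<exists>h t. A = mk h t 0)" for A
  proof -
    have "A \<in> span {mk 1 0 0, mk 0 1 0} \<longleftrightarrow> (\<exists>h t. A = h *\<^sub>R mk 1 0 0 + t *\<^sub>R mk 0 1 0)"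
      by (auto simp: span_insert span_singleton image_iff diff_eq_eq add.commute)
    then show ?thesis by simp
  qed
  ultimately show ?thesis by auto
qed

lemma matrix_exp_sym:
  assumes r: "r = sqrt (h\<^sup>2 + t\<^sup>2)"
  shows "matrix_exp (mk h t 0) = cosh r *\<^sub>R mat 1 + (sinh r / r) *\<^sub>R mk h t 0"
proof -
  let ?M = "mk h t 0"
  \<comment> \<open>Since the square of \<open>?M\<close> is r^2 times the identity,
    \<open>E 1\<close> and \<open>E (- 1)\<close> are its spectral projections for r and -r. If r =
    0, then \<open>?M\<close> is 0 and both are half the identity, so the formulas survive division
    by zero.\<close>
  define E where "E \<sigma> = (1/2) *\<^sub>R (mat 1 + (\<sigma> / r) *\<^sub>R ?M)" for \<sigma> :: real
  have sq: "h * h + t * t = r * r" using r by (simp add: power2_eq_square[symmetric])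
  have r0: "h = 0 \<and> t = 0" if "r = 0" using that r by (simp add: sum_power2_eq_zero_iff)
  have step: "?M ** E \<sigma> = (\<sigma> * r) *\<^sub>R E \<sigma>" if "\<sigma> = 1 \<or> \<sigma> = - 1" for \<sigma>
  proof (cases "r = 0")
    case False
    have "h * (h * 2) + t * (t * 2) = r * (r * 2)" using sq by algebra
    then show ?thesis
      using that False by (auto simp: E_def mat22_eq_iff mat22_mult_nth field_simps)
  qed (use r0 in \<open>simp add: E_def mat22_eq_iff mat22_mult_nth\<close>)
  have pow: "(((**) ?M) ^^ n) (mat 1) = r ^ n *\<^sub>R E 1 + (- r) ^ n *\<^sub>R E (- 1)" for n
  proof (induction n)
    case 0
    show ?case by (simp add: E_def mat22_eq_iff flip: add_divide_distrib)
  next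
    case (Suc n)
    have "A ** (a *\<^sub>R B) = a *\<^sub>R (A ** B)" for a and A B :: "real^2^2"
      by (simp add: mat22_eq_iff mat22_mult_nth algebra_simps)
    then show ?case
      using Suc step[of 1] step[of "-1"]
      by (simp add: matrix_add_ldistrib mult.commute del: mk_scaleR)
  qed
  have "(\<lambda>n. (r ^ n /\<^sub>R fact n) *\<^sub>R E 1 + ((- r) ^ n /\<^sub>R fact n) *\<^sub>R E (- 1))
      sums (exp r *\<^sub>R E 1 + exp (- r) *\<^sub>R E (- 1))"
    by (intro sums_add sums_scaleR_left exp_converges)
  then have "matrix_exp ?M = exp r *\<^sub>R E 1 + exp (- r) *\<^sub>R E (- 1)"
    unfolding matrix_exp_def pow by (simp add: sums_iff scaleR_add_right divide_inverse mult.commute)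
  moreover have "exp r *\<^sub>R E 1 + exp (- r) *\<^sub>R E (- 1) =
      cosh r *\<^sub>R mat 1 + (sinh r / r) *\<^sub>R mk h t 0"
    by (simp add: E_def mat22_eq_iff cosh_field_def sinh_field_def algebra_simps
        add_divide_distrib diff_divide_distrib)
  ultimately show ?thesis by simp
qed

text \<open>Comparing entries with \<open>matrix_exp_sym\<close> gives u = cosh r and (m1, m2) =
  (sinh r / r) (t, -h), which \<open>arsinh\<close> inverts.\<close>

lemma matrix_exp_image: "matrix_exp ` span {matH, matT} = {bmat m1 m2 | m1 m2. True}"
proof (intro equalityI subsetI)
  fix A assume "A \<in> matrix_exp ` span {matH, matT}"
  then obtain h t where A: "A = matrix_exp (mk h t 0)" by (auto simp: span_matH_matT)
  define r where "r = sqrt (h\<^sup>2 + t\<^sup>2)"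
  define c where "c = sinh r / r"
  have sq: "h\<^sup>2 + t\<^sup>2 = r\<^sup>2" by (simp add: r_def)
  have "c\<^sup>2 * (h\<^sup>2 + t\<^sup>2) = (sinh r)\<^sup>2" unfolding sq by (simp add: c_def power_divide)
  then have "bu (c * t) (- c * h) = cosh r"
    by (intro bu_unique) (auto simp: cosh_square_eq power_mult_distrib algebra_simps cosh_real_pos)
  then have "A = bmat (c * t) (- c * h)"
    unfolding A matrix_exp_sym[OF r_def] c_def[symmetric] by (simp add: mat22_eq_iff algebra_simps)
  then show "A \<in> {bmat m1 m2 | m1 m2. True}" by blast
next
  fix A assume "A \<in> {bmat m1 m2 | m1 m2. True}"
  then obtain m1 m2 where A: "A = bmat m1 m2" by blast
  define \<mu> where "\<mu> = sqrt (m1\<^sup>2 + m2\<^sup>2)"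
  define r where "r = arsinh \<mu>"
  \<comment> \<open>For \<open>\<mu> = 0\<close> the quotient \<open>r / \<mu>\<close> is 0, which
    gives the zero matrix, as it should.\<close>
  define h t where "h = - r / \<mu> * m2" and "t = r / \<mu> * m1"
  have sinh: "sinh r = \<mu>" by (simp add: r_def)
  have sq: "m1\<^sup>2 + m2\<^sup>2 = \<mu>\<^sup>2" by (simp add: \<mu>_def)
  have cosh: "cosh r = bu m1 m2"
    using sq by (intro bu_unique[symmetric]) (auto simp: cosh_square_eq sinh cosh_real_pos)
  have \<mu>0: "\<mu> = 0 \<Longrightarrow> m1 = 0 \<and> m2 = 0" using sq by (simp add: sum_power2_eq_zero_iff)
  have r0: "r = 0 \<longleftrightarrow> \<mu> = 0" by (simp add: r_def)
  have "h\<^sup>2 + t\<^sup>2 = (r / \<mu>)\<^sup>2 * (m1\<^sup>2 + m2\<^sup>2)"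
    by (simp add: h_def t_def power_mult_distrib power_divide algebra_simps add_divide_distrib)
  then have "h\<^sup>2 + t\<^sup>2 = r\<^sup>2"
    unfolding sq using r0 by (cases "\<mu> = 0") (auto simp: power_divide)
  moreover have "r \<ge> 0" using sinh sinh_real_nonneg_iff[of r] by (simp add: \<mu>_def)
  ultimately have r: "r = sqrt (h\<^sup>2 + t\<^sup>2)" by simp
  have "A = matrix_exp (mk h t 0)"
    unfolding A matrix_exp_sym[OF r] cosh sinh using r0 \<mu>0
    by (cases "\<mu> = 0") (auto simp: mat22_eq_iff h_def t_def)
  then show "A \<in> matrix_exp ` span {matH, matT}" by (auto simp: span_matH_matT)
qed

lemma Sigma_motions_eq: "Sigma_motions = {motion (bmat m1 m2) 0 | m1 m2. True}"
  unfolding Sigma_motions_def matrix_exp_image by blast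

section \<open>The action of boosts on euclidean planes\<close>

text \<open>The plane with chart p has Lorentz normal (p1, p2, 1). \<open>bs\<close> and
  \<open>bn\<close> are the value s and the l-coordinate of the image when \<open>cj_bmat\<close> is
  applied to this normal, and \<open>boost_chart\<close> rescales the image to l-coordinate
  1.\<close>

definition bs :: "real \<Rightarrow> real \<Rightarrow> real^3 \<Rightarrow> real" where
  "bs m1 m2 p = m1 * p$1 + m2 * p$2 + bu m1 m2"

definition bn :: "real \<Rightarrow> real \<Rightarrow> real^3 \<Rightarrow> real" where
  "bn m1 m2 p = 2 * bu m1 m2 * bs m1 m2 p - 1"

definition boost_chart :: "real \<Rightarrow> real \<Rightarrow> real^3 \<Rightarrow> real^3" where
  "boost_chart m1 m2 p =
    vector [(p$1 + 2 * bs m1 m2 p * m1) / bn m1 m2 p, (p$2 + 2 * bs m1 m2 p * m2) / bn m1 m2 p,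
      p$3 / bn m1 m2 p]"

lemma boost_chart_nth [simp]:
  "boost_chart m1 m2 p $ 1 = (p$1 + 2 * bs m1 m2 p * m1) / bn m1 m2 p"
  "boost_chart m1 m2 p $ 2 = (p$2 + 2 * bs m1 m2 p * m2) / bn m1 m2 p"
  "boost_chart m1 m2 p $ 3 = p$3 / bn m1 m2 p"
  by (simp_all add: boost_chart_def)

text \<open>Boosts keep upward timelike normals upward. With c = m1 p1 + m2 p2, Cauchy-Schwarz
  yields c^2 <= u^2 - 1, which controls both s = u + c and the decomposition of \<open>bn\<close>
  below.\<close>

lemma bs_bn_pos:
  assumes "p \<in> chart_domain"
  shows "bs m1 m2 p > 0" "bn m1 m2 p > 0"
proof -
  define c where "c = m1 * p$1 + m2 * p$2"
  define u where "u = bu m1 m2"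
  have "c\<^sup>2 \<le> (m1\<^sup>2 + m2\<^sup>2) * ((p$1)\<^sup>2 + (p$2)\<^sup>2)"
    using zero_le_power2[of "m1 * p$2 - m2 * p$1"]
    by (simp add: c_def power2_eq_square algebra_simps)
  also have "\<dots> \<le> (m1\<^sup>2 + m2\<^sup>2) * 1"
    using assms by (intro mult_left_mono) (auto simp: chart_domain_def)
  also have eq: "\<dots> = u\<^sup>2 - 1" by (simp add: u_def bu_sq)
  finally have le: "c\<^sup>2 \<le> u\<^sup>2 - 1" .
  then have "\<bar>c\<bar>\<^sup>2 < u\<^sup>2" unfolding power2_abs by linarith
  then have "\<bar>c\<bar> < u"
    by (rule power2_less_imp_less) (simp add: u_def less_imp_le)
  then show s: "bs m1 m2 p > 0" by (simp add: bs_def c_def u_def)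
  have "bn m1 m2 p = (u + c)\<^sup>2 + (u\<^sup>2 - 1 - c\<^sup>2)"
    by (simp add: bn_def bs_def c_def u_def power2_eq_square algebra_simps)
  moreover have "(u + c)\<^sup>2 > 0" using \<open>\<bar>c\<bar> < u\<close> by simp
  ultimately show "bn m1 m2 p > 0" using le by linarith
qed

text \<open>The boost preserves the Lorentz norm of the normal (p1, p2, 1).\<close>

lemma bn_sq:
  "(bn m1 m2 p)\<^sup>2 - (p$1 + 2 * bs m1 m2 p * m1)\<^sup>2 - (p$2 + 2 * bs m1 m2 p * m2)\<^sup>2
    = 1 - (p$1)\<^sup>2 - (p$2)\<^sup>2"
proof -
  define u where "u = bu m1 m2"
  define s where "s = bs m1 m2 p"
  have "u\<^sup>2 = 1 + m1\<^sup>2 + m2\<^sup>2" by (simp add: u_def bu_sq)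
  moreover have "s = m1 * p$1 + m2 * p$2 + u" by (simp add: s_def bs_def u_def)
  ultimately show ?thesis unfolding bn_def s_def[symmetric] u_def[symmetric] by algebra
qed

lemma boost_chart_in_chart_domain:
  assumes "p \<in> chart_domain"
  shows "boost_chart m1 m2 p \<in> chart_domain"
proof -
  have "(p$1 + 2 * bs m1 m2 p * m1)\<^sup>2 + (p$2 + 2 * bs m1 m2 p * m2)\<^sup>2 < (bn m1 m2 p)\<^sup>2"
    using bn_sq[of m1 m2 p] assms by (simp add: chart_domain_def)
  then show ?thesis
    using bs_bn_pos[OF assms, of m1 m2]
    by (simp add: chart_domain_def power_divide flip: add_divide_distrib)
qed

lemma bij_betw_image_eqI:
  assumes "bij_betw g E E" "A \<subseteq> E" "B \<subseteq> E" "\<And>Y. Y \<in> E \<Longrightarrow> g Y \<in> B \<longleftrightarrow> Y \<in> A"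
  shows "g ` A = B"
proof (intro equalityI subsetI)
  fix Z assume "Z \<in> B"
  then have "Z \<in> g ` E" using assms(1,3) by (auto simp: bij_betw_def)
  then show "Z \<in> g ` A" using assms(4) \<open>Z \<in> B\<close> by blast
qed (use assms in blast)

lemma boost_image:
  assumes "p \<in> chart_domain"
  shows "motion (bmat m1 m2) 0 ` plane_of p = plane_of (boost_chart m1 m2 p)"
proof (rule bij_betw_image_eqI[OF bij_betw_motion plane_of_subset plane_of_subset])
  fix Y assume "Y \<in> E21"
  then obtain x k l where Y: "Y = mk x k l" by (rule in_E21E)
  define S where "S = m1 * x + m2 * k + bu m1 m2 * l"
  define s where "s = bs m1 m2 p"
  define n where "n = bn m1 m2 p"
  define u where "u = bu m1 m2"
  have n: "n > 0" using bs_bn_pos[OF assms] by (simp add: n_def)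
  have "motion (bmat m1 m2) 0 Y \<in> plane_of (boost_chart m1 m2 p) \<longleftrightarrow>
    2 * u * S - l = (p$1 + 2 * s * m1) / n * (x + 2 * S * m1)
      + (p$2 + 2 * s * m2) / n * (k + 2 * S * m2) + p$3 / n"
    by (simp add: Y motion_apply cj_bmat Let_def in_plane_of S_def s_def n_def u_def)
  also have "\<dots> \<longleftrightarrow> n * (2 * u * S - l) = (p$1 + 2 * s * m1) * (x + 2 * S * m1)
      + (p$2 + 2 * s * m2) * (k + 2 * S * m2) + p$3"
  proof -
    have "A = B / n * C + D / n * E + F / n \<longleftrightarrow> n * A = B * C + D * E + F" for A B C D E F
    proof -
      have eq: "B / n * C + D / n * E + F / n = (B * C + D * E + F) / n"
        by (simp add: add_divide_distrib)
      show ?thesis unfolding eq using n by (simp add: eq_divide_eq mult.commute[of A])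
    qed
    then show ?thesis .
  qed
  also have "\<dots> \<longleftrightarrow> l = p$1 * x + p$2 * k + p$3"
  proof -
    have "u\<^sup>2 = 1 + m1\<^sup>2 + m2\<^sup>2" by (simp add: u_def bu_sq)
    moreover have "s = m1 * p$1 + m2 * p$2 + u" by (simp add: s_def bs_def u_def)
    moreover have "S = m1 * x + m2 * k + u * l" by (simp add: S_def u_def)
    moreover have "n = 2 * u * s - 1" by (simp add: n_def bn_def u_def s_def)
    \<comment> \<open>The boost preserves the Lorentz product of the point with the normal (p1, p2,
      1); only the constant p3 remains to be compared.\<close>
    ultimately have "n * (2 * u * S - l) - ((p$1 + 2 * s * m1) * (x + 2 * S * m1)
      + (p$2 + 2 * s * m2) * (k + 2 * S * m2)) = l - (p$1 * x + p$2 * k)"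
      by algebra
    then show ?thesis by linarith
  qed
  finally show "motion (bmat m1 m2) 0 Y \<in> plane_of (boost_chart m1 m2 p) \<longleftrightarrow> Y \<in> plane_of p"
    by (simp add: Y in_plane_of)
qed simp_all

text \<open>Read off from the inverse motions through injectivity of \<open>plane_of\<close>,
  instead of computing with the fractions.\<close>

lemma boost_chart_inverse:
  assumes "p \<in> chart_domain"
  shows "boost_chart m1 m2 (boost_chart (- m1) (- m2) p) = p"
proof -
  have "plane_of (boost_chart m1 m2 (boost_chart (- m1) (- m2) p))
      = motion (bmat m1 m2) 0 ` motion (bmat (- m1) (- m2)) 0 ` plane_of p"
    using assms by (simp add: boost_image boost_chart_in_chart_domain)
  also have "\<dots> = (\<lambda>Y. Y) ` plane_of p"
    unfolding image_image
    using plane_of_subset[of p] by (intro image_cong)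
      (auto simp: motion_apply subset_eq adj2_in_SL2 simp flip: adj2_bmat)
  finally show ?thesis by (simp add: inj_eq[OF inj_plane_of])
qed

section \<open>Boosts act sharply transitively on directions of planes\<close>

text \<open>The Lorentz factor that scales (p1, p2, 1) to a unit timelike normal.\<close>

definition hyp_weight :: "real^3 \<Rightarrow> real" where
  "hyp_weight p = 1 / sqrt (1 - (p$1)\<^sup>2 - (p$2)\<^sup>2)"

text \<open>Lorentz length of the unit normal of q minus the mirror image under l -> -l of the unit
  normal of p; this difference is the vector to be normalised into (m1, m2, u).\<close>

definition boost_norm :: "real^3 \<Rightarrow> real^3 \<Rightarrow> real" where
  "boost_norm p q =
    sqrt ((hyp_weight p + hyp_weight q)\<^sup>2 - (hyp_weight q * q$1 - hyp_weight p * p$1)\<^sup>2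
      - (hyp_weight q * q$2 - hyp_weight p * p$2)\<^sup>2)"

definition boost_par :: "3 \<Rightarrow> real^3 \<Rightarrow> real^3 \<Rightarrow> real" where
  "boost_par i p q = (hyp_weight q * q$i - hyp_weight p * p$i) / boost_norm p q"

lemma hyp_weight:
  assumes "p \<in> chart_domain"
  shows "hyp_weight p > 0" "(hyp_weight p)\<^sup>2 * (1 - (p$1)\<^sup>2 - (p$2)\<^sup>2) = 1"
  using assms by (auto simp: hyp_weight_def chart_domain_def power_divide)

lemma inner_chart_domain_less:
  assumes "p \<in> chart_domain" "q \<in> chart_domain"
  shows "\<bar>p$1 * q$1 + p$2 * q$2\<bar> < 1"
proof -
  have "(p$1 * q$1 + p$2 * q$2)\<^sup>2 \<le> ((p$1)\<^sup>2 + (p$2)\<^sup>2) * ((q$1)\<^sup>2 + (q$2)\<^sup>2)"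
    using zero_le_power2[of "p$1 * q$2 - p$2 * q$1"]
    by (simp add: power2_eq_square algebra_simps)
  also have "\<dots> < 1 * 1"
    using assms by (intro mult_strict_mono') (auto simp: chart_domain_def)
  finally show ?thesis by (simp add: abs_square_less_1)
qed

text \<open>Expanding with both normals of unit length leaves only the mixed term, which is positive
  because the inner product of two points of the open disc exceeds -1.\<close>

lemma boost_norm_sq_pos:
  assumes "p \<in> chart_domain" "q \<in> chart_domain"
  shows "(hyp_weight p + hyp_weight q)\<^sup>2 - (hyp_weight q * q$1 - hyp_weight p * p$1)\<^sup>2
      - (hyp_weight q * q$2 - hyp_weight p * p$2)\<^sup>2 > 0" (is ?pos)
    and "(hyp_weight p + hyp_weight q)\<^sup>2 - (hyp_weight q * q$1 - hyp_weight p * p$1)\<^sup>2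
      - (hyp_weight q * q$2 - hyp_weight p * p$2)\<^sup>2
      = 2 + 2 * hyp_weight p * hyp_weight q * (1 + p$1 * q$1 + p$2 * q$2)" (is ?eq)
proof -
  show eq: ?eq
    using hyp_weight(2)[OF assms(1)] hyp_weight(2)[OF assms(2)] by algebra
  have "1 + p$1 * q$1 + p$2 * q$2 > 0" using inner_chart_domain_less[OF assms] by linarith
  then have "hyp_weight p * hyp_weight q * (1 + p$1 * q$1 + p$2 * q$2) > 0"
    using hyp_weight(1)[OF assms(1)] hyp_weight(1)[OF assms(2)] by simp
  then show ?pos
    unfolding eq mult.assoc by linarith
qed

lemma boost_par_eqs:
  assumes "p \<in> chart_domain" "q \<in> chart_domain"
  shows "boost_norm p q > 0"
    "boost_norm p q * boost_par 1 p q = hyp_weight q * q$1 - hyp_weight p * p$1"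
    "boost_norm p q * boost_par 2 p q = hyp_weight q * q$2 - hyp_weight p * p$2"
    "boost_norm p q * bu (boost_par 1 p q) (boost_par 2 p q) = hyp_weight p + hyp_weight q"
    "(boost_norm p q)\<^sup>2 = 2 + 2 * hyp_weight p * hyp_weight q * (1 + p$1 * q$1 + p$2 * q$2)"
proof -
  let ?K = "boost_norm p q" and ?L = "hyp_weight p + hyp_weight q"
  show K: "?K > 0" using boost_norm_sq_pos(1)[OF assms] by (simp add: boost_norm_def)
  show 1: "?K * boost_par 1 p q = hyp_weight q * q$1 - hyp_weight p * p$1"
    and 2: "?K * boost_par 2 p q = hyp_weight q * q$2 - hyp_weight p * p$2"
    using K by (simp_all add: boost_par_def)
  have sq: "?K\<^sup>2 = ?L\<^sup>2 - (?K * boost_par 1 p q)\<^sup>2 - (?K * boost_par 2 p q)\<^sup>2"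
    unfolding 1 2 using boost_norm_sq_pos(1)[OF assms] by (simp add: boost_norm_def)
  then have "bu (boost_par 1 p q) (boost_par 2 p q) = ?L / ?K"
    using K hyp_weight(1)[OF assms(1)] hyp_weight(1)[OF assms(2)]
    by (intro bu_unique) (auto simp: power_divide field_simps)
  then show "?K * bu (boost_par 1 p q) (boost_par 2 p q) = ?L" using K by simp
  show "?K\<^sup>2 = 2 + 2 * hyp_weight p * hyp_weight q * (1 + p$1 * q$1 + p$2 * q$2)"
    using boost_norm_sq_pos[OF assms] by (simp add: boost_norm_def)
qed

text \<open>A boost with parameter \<open>m\<close> maps a unit timelike normal \<open>(x, l)\<close> to \<open>(x', l')\<close> with
  \<open>(x' - x, l' + l) = 2 s (m, u)\<close>. As \<open>(m, u)\<close> has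
  Lorentz length \<open>1\<close>, the left-hand side determines \<open>m\<close>.\<close>

lemma boost_chart_eq_iff:
  assumes p: "p \<in> chart_domain" and q: "q \<in> chart_domain"
  shows "boost_chart m1 m2 p $ 1 = q$1 \<and> boost_chart m1 m2 p $ 2 = q$2 \<longleftrightarrow>
    m1 = boost_par 1 p q \<and> m2 = boost_par 2 p q" (is "?L \<longleftrightarrow> ?R")
proof
  define s n u K wp wq where "s = bs m1 m2 p" and "n = bn m1 m2 p" and "u = bu m1 m2"
    and "K = boost_norm p q" and "wp = hyp_weight p" and "wq = hyp_weight q"
  note defs = s_def n_def u_def K_def wp_def wq_def
  have s: "s > 0" and n: "n > 0" using bs_bn_pos[OF p] by (simp_all add: defs)
  have u: "u > 0" "u\<^sup>2 = 1 + m1\<^sup>2 + m2\<^sup>2" by (simp_all add: u_def bu_sq)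
  have seq: "s = m1 * p$1 + m2 * p$2 + u" by (simp add: bs_def defs)
  have neq: "n = 2 * u * s - 1" by (simp add: bn_def defs)
  have wp: "wp > 0" "wp\<^sup>2 * (1 - (p$1)\<^sup>2 - (p$2)\<^sup>2) = 1" using hyp_weight[OF p] by (simp_all add: defs)
  have wq: "wq > 0" "wq\<^sup>2 * (1 - (q$1)\<^sup>2 - (q$2)\<^sup>2) = 1" using hyp_weight[OF q] by (simp_all add: defs)
  note par = boost_par_eqs[OF p q, folded defs]
  { assume ?L
    then have e1: "p$1 + 2 * s * m1 = n * q$1" and e2: "p$2 + 2 * s * m2 = n * q$2"
      using n by (simp_all add: defs field_simps)
    \<comment> \<open>Invariance of the Lorentz norm fixes the rescaling factor n as the quotient wq
      / wp of the two weights.\<close>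
    have "n\<^sup>2 * (1 - (q$1)\<^sup>2 - (q$2)\<^sup>2) = 1 - (p$1)\<^sup>2 - (p$2)\<^sup>2"
      using bn_sq[of m1 m2 p] e1 e2 by (simp add: defs power_mult_distrib algebra_simps)
    then have "(wp * n)\<^sup>2 * ((1 - (q$1)\<^sup>2 - (q$2)\<^sup>2) * wq\<^sup>2) = (wp\<^sup>2 * (1 - (p$1)\<^sup>2 - (p$2)\<^sup>2)) * wq\<^sup>2"
      by algebra
    then have "(wp * n)\<^sup>2 = wq\<^sup>2" using wp(2) wq(2) by (simp add: mult.commute)
    then have wn: "wp * n = wq" using wp(1) wq(1) n by (simp add: power2_eq_iff_nonneg)
    have f1: "2 * s * wp * m1 = wq * q$1 - wp * p$1" and f2: "2 * s * wp * m2 = wq * q$2 - wp * p$2"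
      and f3: "2 * s * wp * u = wp + wq"
      using e1 e2 wn neq by algebra+
    \<comment> \<open>By f1 to f3 the vector to be normalised is 2 s wp times the unit vector (m1,
      m2, u); comparing lengths gives K = 2 s wp.\<close>
    have "K\<^sup>2 = (wp + wq)\<^sup>2 - (wq * q$1 - wp * p$1)\<^sup>2 - (wq * q$2 - wp * p$2)\<^sup>2"
      using par(5) boost_norm_sq_pos(2)[OF p q] by (simp add: defs)
    also have "\<dots> = (2 * s * wp)\<^sup>2 * (u\<^sup>2 - m1\<^sup>2 - m2\<^sup>2)"
      unfolding f1[symmetric] f2[symmetric] f3[symmetric] by algebra
    finally have "K\<^sup>2 = (2 * s * wp)\<^sup>2" using u(2) by simp
    then have K: "K = 2 * s * wp" using par(1) s wp(1) by (simp add: power2_eq_iff_nonneg)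
    show ?R using par(1-3) f1 f2 unfolding K[symmetric] by (metis less_irrefl mult_cancel_left) }
  { assume ?R
    then have f: "K * m1 = wq * q$1 - wp * p$1" "K * m2 = wq * q$2 - wp * p$2" "K * u = wp + wq"
      using par by (simp_all add: u_def)
    \<comment> \<open>Substituting f, K s becomes wp (1 - |p|^2) + wq (1 + p . q) in the disc
      coordinates; multiplied by 2 wp this is the expression for K^2 in
      \<open>par(5)\<close>.\<close>
    have "K * (2 * wp * s) = K * K"
      using f seq par(5) wp(2) by algebra
    then have K: "2 * wp * s = K" using par(1) by simp
    have wn: "wp * n = wq" using f(3) K neq by algebra
    have "wp * (p$1 + 2 * s * m1) = wp * (n * q$1)" "wp * (p$2 + 2 * s * m2) = wp * (n * q$2)"
      using f K wn by algebra+
    then have "p$1 + 2 * s * m1 = n * q$1" "p$2 + 2 * s * m2 = n * q$2"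
      using wp(1) by simp_all
    then show ?L using n by (simp add: defs field_simps) }
qed

section \<open>Sections transversal to the planes\<close>

text \<open>(d1, d2, 1) spans the line S; the assumption says that this vector is parallel to no
  euclidean plane.\<close>

locale transversal =
  fixes d1 d2 :: real
  assumes slope_ne: "p \<in> chart_domain \<Longrightarrow> 1 - d1 * p$1 - d2 * p$2 \<noteq> 0"
begin

text \<open>The growth of the height p3 per unit of translation along (d1, d2, 1).\<close>

definition slope :: "real^3 \<Rightarrow> real" where
  "slope p = 1 - d1 * p$1 - d2 * p$2"

definition shift_chart :: "real \<Rightarrow> real^3 \<Rightarrow> real^3" where
  "shift_chart t p = vector [p$1, p$2, p$3 + t * slope p]"

lemma shift_chart_nth [simp]:
  "shift_chart t p $ 1 = p$1" "shift_chart t p $ 2 = p$2" "shift_chart t p $ 3 = p$3 + t * slope p"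
  by (simp_all add: shift_chart_def)

lemma shift_chart_in_chart_domain [simp]: "shift_chart t p \<in> chart_domain \<longleftrightarrow> p \<in> chart_domain"
  by (simp add: chart_domain_def)

lemma shift_chart_shift_chart [simp]: "shift_chart s (shift_chart t p) = shift_chart (s + t) p"
  by (simp add: vec3_eq_iff slope_def algebra_simps)

lemma shift_chart_0 [simp]: "shift_chart 0 p = p"
  by (simp add: vec3_eq_iff)

definition theta :: "real \<Rightarrow> real \<Rightarrow> real \<Rightarrow> real^2^2 \<Rightarrow> real^2^2" where
  "theta m1 m2 t = motion (bmat m1 m2) (t *\<^sub>R mk d1 d2 1)"

definition Thetas :: "(real^2^2 \<Rightarrow> real^2^2) set" where
  "Thetas = {theta m1 m2 t | m1 m2 t. True}"

lemma theta_in_Thetas [simp]: "theta m1 m2 t \<in> Thetas"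
  by (auto simp: Thetas_def)

lemma Thetas_subset: "Thetas \<subseteq> motion_group"
  unfolding Thetas_def theta_def motion_group_def by (auto simp del: mk_scaleR)
    (metis bmat_in_SL2 mk_in_E21 mk_scaleR)

lemma theta_eq_compose:
  "theta m1 m2 t = compose E21 (motion (mat 1) (t *\<^sub>R mk d1 d2 1)) (motion (bmat m1 m2) 0)"
proof -
  have "cj (mat 1) 0 + t *\<^sub>R mk d1 d2 1 = t *\<^sub>R mk d1 d2 1" by simp
  then show ?thesis
    unfolding theta_def by (simp add: compose_motion del: mk_scaleR)
qed

lemma translation_image:
  "motion (mat 1) (t *\<^sub>R mk d1 d2 1) ` plane_of p = plane_of (shift_chart t p)"
proof (rule bij_betw_image_eqI[OF bij_betw_motion plane_of_subset plane_of_subset])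
  fix Y assume "Y \<in> E21"
  then obtain x k l where Y: "Y = mk x k l" by (rule in_E21E)
  show "motion (mat 1) (t *\<^sub>R mk d1 d2 1) Y \<in> plane_of (shift_chart t p) \<longleftrightarrow> Y \<in> plane_of p"
    by (auto simp: Y motion_apply in_plane_of slope_def algebra_simps)
qed simp_all

lemma theta_image:
  assumes "p \<in> chart_domain"
  shows "theta m1 m2 t ` plane_of p = plane_of (shift_chart t (boost_chart m1 m2 p))"
proof -
  have "theta m1 m2 t ` plane_of p
      = motion (mat 1) (t *\<^sub>R mk d1 d2 1) ` motion (bmat m1 m2) 0 ` plane_of p"
    unfolding theta_eq_compose image_image using plane_of_subset[of p]
    by (intro image_cong) (auto simp: compose_eq)
  then show ?thesis by (simp add: boost_image assms translation_image del: mk_scaleR)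
qed

text \<open>The boost has already turned the plane into the direction of q, so the remaining height
  difference is divided by the slope at q.\<close>

definition shift_par :: "real^3 \<Rightarrow> real^3 \<Rightarrow> real" where
  "shift_par p q = (q$3 - boost_chart (boost_par 1 p q) (boost_par 2 p q) p $ 3) / slope q"

lemma theta_image_eq_iff:
  assumes "p \<in> chart_domain" "q \<in> chart_domain"
  shows "theta m1 m2 t ` plane_of p = plane_of q \<longleftrightarrow>
    m1 = boost_par 1 p q \<and> m2 = boost_par 2 p q \<and> t = shift_par p q"
proof -
  let ?r = "boost_chart m1 m2 p"
  have "theta m1 m2 t ` plane_of p = plane_of q \<longleftrightarrow> shift_chart t ?r = q"
    by (simp add: theta_image assms inj_eq[OF inj_plane_of])
  also have "\<dots> \<longleftrightarrow> (?r$1 = q$1 \<and> ?r$2 = q$2) \<and> ?r$3 + t * slope q = q$3"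
    by (auto simp: vec3_eq_iff slope_def simp del: boost_chart_nth)
  also have "\<dots> \<longleftrightarrow> (m1 = boost_par 1 p q \<and> m2 = boost_par 2 p q) \<and> t = shift_par p q"
    unfolding boost_chart_eq_iff[OF assms]
    using slope_ne[OF assms(2)]
    by (auto simp: shift_par_def slope_def eq_divide_eq algebra_simps simp del: boost_chart_nth)
  finally show ?thesis by simp
qed

definition theta_to :: "real^3 \<Rightarrow> real^3 \<Rightarrow> real^2^2 \<Rightarrow> real^2^2" where
  "theta_to p q = theta (boost_par 1 p q) (boost_par 2 p q) (shift_par p q)"

lemma theta_to_eq_iff:
  assumes "p \<in> chart_domain" "q \<in> chart_domain"
  shows "\<rho> \<in> Thetas \<and> \<rho> ` plane_of p = plane_of q \<longleftrightarrow> \<rho> = theta_to p q"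
proof -
  have "theta_to p q ` plane_of p = plane_of q"
    by (simp add: theta_image_eq_iff[OF assms] theta_to_def)
  moreover have "\<rho> = theta_to p q" if "\<rho> \<in> Thetas" "\<rho> ` plane_of p = plane_of q"
    using that theta_image_eq_iff[OF assms] by (auto simp: Thetas_def theta_to_def)
  moreover have "theta_to p q \<in> Thetas" by (simp add: theta_to_def)
  ultimately show ?thesis by blast
qed

lemma sharply_transitive_Thetas: "sharply_transitive_on_planes Thetas"
  unfolding sharply_transitive_on_planes_def
proof (intro conjI ballI)
  fix \<rho> D assume "\<rho> \<in> Thetas" "D \<in> \<Psi>"
  then show "\<rho> ` D \<in> \<Psi>"
    using Thetas_subset motion_Psi by (force simp: motion_group_def)
next
  fix D1 D2 assume "D1 \<in> \<Psi>" "D2 \<in> \<Psi>"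
  then obtain p q where "p \<in> chart_domain" "D1 = plane_of p" "q \<in> chart_domain" "D2 = plane_of q"
    by (metis Psi_plane_of)
  then show "\<exists>!\<rho>. \<rho> \<in> Thetas \<and> \<rho> ` D1 = D2"
    using theta_to_eq_iff by auto
qed

end

section \<open>The loop in the chart\<close>

locale transversal_base = transversal +
  fixes e :: "real^3"
  assumes e: "e \<in> chart_domain"
begin

definition mult_chart :: "real^3 \<Rightarrow> real^3 \<Rightarrow> real^3" where
  "mult_chart x y =
    shift_chart (shift_par e x) (boost_chart (boost_par 1 e x) (boost_par 2 e x) y)"

definition ldiv_chart :: "real^3 \<Rightarrow> real^3 \<Rightarrow> real^3" where
  "ldiv_chart x z =
    boost_chart (- boost_par 1 e x) (- boost_par 2 e x) (shift_chart (- shift_par e x) z)"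

text \<open>If x y = z, then the motion belonging to x is the one carrying y to z, and x is
  recovered as its value at the base point e.\<close>

definition rdiv_chart :: "real^3 \<Rightarrow> real^3 \<Rightarrow> real^3" where
  "rdiv_chart z y =
    shift_chart (shift_par y z) (boost_chart (boost_par 1 y z) (boost_par 2 y z) e)"

lemma chart_ops_closed [simp]:
  "x \<in> chart_domain \<Longrightarrow> y \<in> chart_domain \<Longrightarrow> mult_chart x y \<in> chart_domain"
  "x \<in> chart_domain \<Longrightarrow> y \<in> chart_domain \<Longrightarrow> ldiv_chart x y \<in> chart_domain"
  "x \<in> chart_domain \<Longrightarrow> y \<in> chart_domain \<Longrightarrow> rdiv_chart x y \<in> chart_domain"
  using e by (simp_all add: mult_chart_def ldiv_chart_def rdiv_chart_def boost_chart_in_chart_domain)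

abbreviation pm :: "(real^2^2) set \<Rightarrow> (real^2^2) set \<Rightarrow> (real^2^2) set" where
  "pm \<equiv> plane_mult Thetas (plane_of e)"

lemma pm_eq_image:
  assumes "x \<in> chart_domain"
  shows "pm (plane_of x) D = theta_to e x ` D"
proof -
  have "(THE \<rho>. \<rho> \<in> Thetas \<and> \<rho> ` plane_of e = plane_of x) = theta_to e x"
    using theta_to_eq_iff[OF e assms] by (intro the_equality) auto
  then show ?thesis by (simp add: plane_mult_def)
qed

lemma pm_plane_of:
  assumes "x \<in> chart_domain" "y \<in> chart_domain"
  shows "pm (plane_of x) (plane_of y) = plane_of (mult_chart x y)"
  by (simp add: pm_eq_image assms theta_to_def theta_image mult_chart_def)

lemma mult_chart_eq_iff_ldiv:
  assumes "x \<in> chart_domain" "y \<in> chart_domain" "z \<in> chart_domain"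
  shows "mult_chart x y = z \<longleftrightarrow> y = ldiv_chart x z"
  using assms boost_chart_inverse[of y "- boost_par 1 e x" "- boost_par 2 e x"]
    boost_chart_inverse[of "shift_chart (- shift_par e x) z" "boost_par 1 e x" "boost_par 2 e x"]
  by (auto simp: mult_chart_def ldiv_chart_def)

text \<open>Both sides say that the parameters of the motions e -> x and y -> z coincide.\<close>

lemma mult_chart_eq_iff_rdiv:
  assumes "x \<in> chart_domain" "y \<in> chart_domain" "z \<in> chart_domain"
  shows "mult_chart x y = z \<longleftrightarrow> x = rdiv_chart z y"
proof -
  have "mult_chart x y = z \<longleftrightarrow> theta_to e x ` plane_of y = plane_of z"
    by (simp add: theta_to_def theta_image assms mult_chart_def inj_eq[OF inj_plane_of])
  also have "\<dots> \<longleftrightarrow> boost_par 1 e x = boost_par 1 y z \<and> boost_par 2 e x = boost_par 2 y z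
      \<and> shift_par e x = shift_par y z"
    by (simp add: theta_to_def theta_image_eq_iff assms)
  also have "\<dots> \<longleftrightarrow> theta_to y z ` plane_of e = plane_of x"
    unfolding theta_to_def theta_image_eq_iff[OF e assms(1)] by auto
  also have "\<dots> \<longleftrightarrow> x = rdiv_chart z y"
    by (auto simp: theta_to_def theta_image e rdiv_chart_def inj_eq[OF inj_plane_of])
  finally show ?thesis .
qed

lemma mult_chart_right_unit: "x \<in> chart_domain \<Longrightarrow> mult_chart x e = x"
  using theta_image_eq_iff[OF e, of x] by (simp add: theta_image e mult_chart_def inj_eq[OF inj_plane_of])

lemma mult_chart_left_unit: "x \<in> chart_domain \<Longrightarrow> mult_chart e x = x"
proof -
  have "bn 0 0 p = 1" for p by (simp add: bn_def bs_def bu_def)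
  then have boost_0: "boost_chart 0 0 p = p" for p by (simp add: vec3_eq_iff)
  \<comment> \<open>The identity motion lies in \<open>Thetas\<close>, so uniqueness forces the
    parameters of e -> e to vanish.\<close>
  have "theta 0 0 0 ` plane_of e = plane_of e" by (simp add: theta_image e boost_0)
  then have "boost_par 1 e e = 0" "boost_par 2 e e = 0" "shift_par e e = 0"
    using theta_image_eq_iff[OF e e] by metis+
  then show ?thesis by (simp add: mult_chart_def boost_0)
qed

lemma ldiv_pm:
  assumes "x \<in> chart_domain" "z \<in> chart_domain"
  shows "\<exists>!D. D \<in> \<Psi> \<and> pm (plane_of x) D = plane_of z"
    and "loop_ldiv \<Psi> pm (plane_of x) (plane_of z) = plane_of (ldiv_chart x z)"
proof -
  \<comment> \<open>This equivalence yields unique solvability and the value of the description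
    operator together.\<close>
  have *: "D \<in> \<Psi> \<and> pm (plane_of x) D = plane_of z \<longleftrightarrow> D = plane_of (ldiv_chart x z)" for D
  proof (cases "D \<in> \<Psi>")
    case True
    then obtain w where "w \<in> chart_domain" "D = plane_of w" by (rule Psi_plane_of)
    then show ?thesis
      using assms
      by (simp add: pm_plane_of plane_of_in_Psi inj_eq[OF inj_plane_of] mult_chart_eq_iff_ldiv)
  qed (use assms plane_of_in_Psi in auto)
  then show "\<exists>!D. D \<in> \<Psi> \<and> pm (plane_of x) D = plane_of z"
    and "loop_ldiv \<Psi> pm (plane_of x) (plane_of z) = plane_of (ldiv_chart x z)"
    unfolding loop_ldiv_def by auto
qed

lemma rdiv_pm:
  assumes "y \<in> chart_domain" "z \<in> chart_domain"
  shows "\<exists>!D. D \<in> \<Psi> \<and> pm D (plane_of y) = plane_of z"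
    and "loop_rdiv \<Psi> pm (plane_of z) (plane_of y) = plane_of (rdiv_chart z y)"
proof -
  have *: "D \<in> \<Psi> \<and> pm D (plane_of y) = plane_of z \<longleftrightarrow> D = plane_of (rdiv_chart z y)" for D
  proof (cases "D \<in> \<Psi>")
    case True
    then obtain w where "w \<in> chart_domain" "D = plane_of w" by (rule Psi_plane_of)
    then show ?thesis
      using assms
      by (simp add: pm_plane_of plane_of_in_Psi inj_eq[OF inj_plane_of] mult_chart_eq_iff_rdiv)
  qed (use assms plane_of_in_Psi in auto)
  then show "\<exists>!D. D \<in> \<Psi> \<and> pm D (plane_of y) = plane_of z"
    and "loop_rdiv \<Psi> pm (plane_of z) (plane_of y) = plane_of (rdiv_chart z y)"
    unfolding loop_rdiv_def by auto
qed

lemma is_loop_pm: "is_loop \<Psi> pm (plane_of e)"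
  unfolding is_loop_def
proof (intro conjI ballI)
  fix D D' assume "D \<in> \<Psi>" "D' \<in> \<Psi>"
  then obtain x y where *: "x \<in> chart_domain" "D = plane_of x" "y \<in> chart_domain" "D' = plane_of y"
    by (metis Psi_plane_of)
  then show "pm D D' \<in> \<Psi>" by (simp add: pm_plane_of plane_of_in_Psi)
  show "\<exists>!y. y \<in> \<Psi> \<and> pm D y = D'" using * ldiv_pm(1) by simp
  show "\<exists>!x. x \<in> \<Psi> \<and> pm x D = D'" using * rdiv_pm(1) by simp
next
  fix D assume "D \<in> \<Psi>"
  then obtain x where "x \<in> chart_domain" "D = plane_of x" by (rule Psi_plane_of)
  then show "pm (plane_of e) D = D" "pm D (plane_of e) = D"
    by (simp_all add: pm_plane_of e mult_chart_left_unit mult_chart_right_unit)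
qed (use e plane_of_in_Psi in auto)

section \<open>Smoothness\<close>

lemma smooth_on_fst_snd [smooth_intros]:
  "open U \<Longrightarrow> smooth_on U (\<lambda>z::(real^3) \<times> (real^3). fst z)"
  "open U \<Longrightarrow> smooth_on U (\<lambda>z::(real^3) \<times> (real^3). snd z)"
  by (auto intro: smooth_on_bounded_linear bounded_linear_fst bounded_linear_snd)

context
  fixes U :: "((real^3) \<times> (real^3)) set"
  assumes U: "open U"
begin

lemma smooth_on_vec3:
  fixes f :: "(real^3) \<times> (real^3) \<Rightarrow> real^3"
  assumes "smooth_on U (\<lambda>x. f x $ 1)" "smooth_on U (\<lambda>x. f x $ 2)" "smooth_on U (\<lambda>x. f x $ 3)"
  shows "smooth_on U f"
proof (rule smooth_on_vec[OF U])
  fix i :: 3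
  show "smooth_on U (\<lambda>x. f x $ i)" using exhaust_3[of i] assms by auto
qed

lemma smooth_on_shift_chart:
  assumes "smooth_on U t" "smooth_on U p"
  shows "smooth_on U (\<lambda>z. shift_chart (t z) (p z))"
  by (rule smooth_on_vec3) (simp_all add: slope_def, (intro smooth_intros U assms)+)

lemma smooth_on_bu:
  assumes "smooth_on U m1" "smooth_on U m2"
  shows "smooth_on U (\<lambda>z. bu (m1 z) (m2 z))"
  unfolding bu_def by (intro smooth_intros U assms) (simp add: add_pos_nonneg)

lemma smooth_on_boost_chart:
  assumes "smooth_on U m1" "smooth_on U m2" "smooth_on U p" "\<And>z. z \<in> U \<Longrightarrow> p z \<in> chart_domain"
  shows "smooth_on U (\<lambda>z. boost_chart (m1 z) (m2 z) (p z))"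
proof -
  have s: "smooth_on U (\<lambda>z. bs (m1 z) (m2 z) (p z))"
    unfolding bs_def by (intro smooth_intros smooth_on_bu U assms)
  then have n: "smooth_on U (\<lambda>z. bn (m1 z) (m2 z) (p z))"
    unfolding bn_def by (intro smooth_intros smooth_on_bu U assms)
  have "bn (m1 z) (m2 z) (p z) \<noteq> 0" if "z \<in> U" for z
    using bs_bn_pos(2)[OF assms(4)[OF that]] by (metis less_irrefl)
  then show ?thesis
    by (intro smooth_on_vec3) (simp_all, (intro smooth_intros U assms s n; simp)+)
qed

lemma smooth_on_hyp_weight:
  assumes "smooth_on U p" "\<And>z. z \<in> U \<Longrightarrow> p z \<in> chart_domain"
  shows "smooth_on U (\<lambda>z. hyp_weight (p z))"
proof -
  have pos: "1 - (p z $ 1)\<^sup>2 - (p z $ 2)\<^sup>2 > 0" if "z \<in> U" for z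
    using assms(2)[OF that] by (simp add: chart_domain_def)
  then have "sqrt (1 - (p z $ 1)\<^sup>2 - (p z $ 2)\<^sup>2) \<noteq> 0" if "z \<in> U" for z
    using that by (metis less_irrefl real_sqrt_gt_zero)
  with pos show ?thesis
    unfolding hyp_weight_def by (intro smooth_intros U assms(1))
qed

lemma smooth_on_boost_par:
  assumes "smooth_on U p" "smooth_on U q"
    and "\<And>z. z \<in> U \<Longrightarrow> p z \<in> chart_domain" "\<And>z. z \<in> U \<Longrightarrow> q z \<in> chart_domain"
  shows "smooth_on U (\<lambda>z. boost_par i (p z) (q z))"
proof -
  have "smooth_on U (\<lambda>z. boost_norm (p z) (q z))"
    unfolding boost_norm_def using boost_norm_sq_pos(1)[OF assms(3,4)]
    by (intro smooth_intros smooth_on_hyp_weight U assms) simp_all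
  moreover have "boost_norm (p z) (q z) \<noteq> 0" if "z \<in> U" for z
    using boost_par_eqs(1)[OF assms(3,4)[OF that]] by (metis less_irrefl)
  ultimately show ?thesis
    unfolding boost_par_def by (intro smooth_intros smooth_on_hyp_weight U assms)
qed

lemma smooth_on_shift_par:
  assumes "smooth_on U p" "smooth_on U q"
    and "\<And>z. z \<in> U \<Longrightarrow> p z \<in> chart_domain" "\<And>z. z \<in> U \<Longrightarrow> q z \<in> chart_domain"
  shows "smooth_on U (\<lambda>z. shift_par (p z) (q z))"
  unfolding shift_par_def slope_def using slope_ne[OF assms(4)]
  by (intro smooth_intros smooth_on_boost_par smooth_on_boost_chart U assms)

end

lemma open_chart_domain_sq: "open (chart_domain \<times> chart_domain)"
  by (intro open_Times open_chart_domain)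

lemma smooth_binary_mapI:
  assumes "\<And>x y. x \<in> chart_domain \<Longrightarrow> y \<in> chart_domain \<Longrightarrow>
      f (plane_of x) (plane_of y) = plane_of (g x y)"
    and "smooth_on (chart_domain \<times> chart_domain) (\<lambda>z. g (fst z) (snd z))"
  shows "smooth_binary_map plane_chart \<Psi> f"
  unfolding smooth_binary_map_def plane_chart_Psi
  by (rule smooth_on_cong[OF open_chart_domain_sq _ assms(2)])
     (auto simp: inv_into_plane_chart assms(1))

lemma differentiable_loop_pm: "differentiable_loop plane_chart \<Psi> pm (plane_of e)"
proof -
  note smooth = smooth_on_shift_chart smooth_on_boost_chart smooth_on_boost_par smooth_on_shift_par
    smooth_intros open_chart_domain_sq
  have "smooth_binary_map plane_chart \<Psi> pm"
    using pm_plane_of by (rule smooth_binary_mapI)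
      (assumption, assumption, unfold mult_chart_def, intro smooth, auto simp: e)
  moreover have "smooth_binary_map plane_chart \<Psi> (loop_rdiv \<Psi> pm)"
    using rdiv_pm(2) by (rule smooth_binary_mapI)
      (assumption, assumption, unfold rdiv_chart_def, intro smooth, auto simp: e)
  moreover have "smooth_binary_map plane_chart \<Psi> (loop_ldiv \<Psi> pm)"
    using ldiv_pm(2) by (rule smooth_binary_mapI)
      (assumption, assumption, unfold ldiv_chart_def, intro smooth, auto simp: e)
  ultimately show ?thesis
    by (simp add: differentiable_loop_def inj_on_plane_chart plane_chart_Psi open_chart_domain is_loop_pm)
qed

end

section \<open>The action of the motion group on the planes\<close>

lemma motion_group_inverse:
  assumes "g \<in> motion_group"
  obtains h where "h \<in> motion_group"
    "compose E21 g h = motion (mat 1) 0" "compose E21 h g = motion (mat 1) 0"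
proof -
  obtain A X where *: "A \<in> SL2" "X \<in> E21" "g = motion A X"
    using assms by (auto simp: motion_group_def)
  define h where "h = motion (adj2 A) (- cj (adj2 A) X)"
  have neg: "cj A (- Y) = - cj A Y" for Y using linear_neg[OF linear_cj] by metis
  have "h \<in> motion_group"
    unfolding h_def motion_group_def using * adj2_in_SL2 uminus_E21 cj_in_E21 by blast
  moreover have "compose E21 g h = motion (mat 1) 0" "compose E21 h g = motion (mat 1) 0"
    using * by (simp_all add: h_def compose_motion adj2_in_SL2 adj2_mult_self neg)
  ultimately show ?thesis using that by blast
qed

lemma motion_group_Psi: "g \<in> motion_group \<Longrightarrow> D \<in> \<Psi> \<Longrightarrow> g ` D \<in> \<Psi>"
  by (auto simp: motion_group_def motion_Psi)

lemma Psi_subset: "D \<in> \<Psi> \<Longrightarrow> D \<subseteq> E21"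
  by (simp add: euclidean_planes_def is_plane_def)

lemma compose_image: "D \<subseteq> E \<Longrightarrow> compose E g h ` D = g ` h ` D"
  by (auto simp: compose_def image_iff)

lemma compose_plane_action:
  assumes "h \<in> motion_group"
  shows "compose \<Psi> (plane_action g) (plane_action h) = plane_action (compose E21 g h)"
  by (rule extensionalityI[of _ \<Psi>])
     (simp_all add: plane_action_def compose_eq compose_image Psi_subset motion_group_Psi assms)

lemma plane_action_id: "plane_action (motion (mat 1) 0) = (\<lambda>D\<in>\<Psi>. D)"
proof (rule extensionalityI[of _ \<Psi>])
  fix D assume "D \<in> \<Psi>"
  then have "(\<lambda>Y\<in>E21. Y) ` D = D" using Psi_subset[of D] by (auto simp: image_iff)
  then show "plane_action (motion (mat 1) 0) D = (\<lambda>D\<in>\<Psi>. D) D"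
    using \<open>D \<in> \<Psi>\<close> by (simp add: plane_action_def motion_id)
qed (simp_all add: plane_action_def)

lemma plane_action_Bij:
  assumes "g \<in> motion_group"
  shows "plane_action g \<in> Bij \<Psi>"
proof -
  obtain h where h: "h \<in> motion_group"
    "compose E21 g h = motion (mat 1) 0" "compose E21 h g = motion (mat 1) 0"
    using motion_group_inverse[OF assms] by blast
  have "compose \<Psi> (plane_action g) (plane_action h) D = D"
    "compose \<Psi> (plane_action h) (plane_action g) D = D" if "D \<in> \<Psi>" for D
    unfolding compose_plane_action[OF h(1)] compose_plane_action[OF assms] h(2,3) plane_action_id
    using that by simp_all
  then have "bij_betw (plane_action g) \<Psi> \<Psi>"
    using assms h(1)
    by (intro bij_betw_byWitness[where f' = "plane_action h"])
       (auto simp: compose_eq plane_action_def motion_group_Psi)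
  then show ?thesis by (simp add: Bij_def plane_action_def)
qed

text \<open>The planes through Y with slopes (0, 0), (1/2, 0) and (0, 1/2) already meet only in
  Y.\<close>

lemma euclidean_planes_separate:
  assumes "Y \<in> E21" "Z \<in> E21" "\<And>D. D \<in> \<Psi> \<Longrightarrow> Y \<in> D \<Longrightarrow> Z \<in> D"
  shows "Z = Y"
proof -
  obtain x k l where Y: "Y = mk x k l" using assms(1) by (rule in_E21E)
  obtain x' k' l' where Z: "Z = mk x' k' l'" using assms(2) by (rule in_E21E)
  have *: "l' = a * x' + b * k' + (l - a * x - b * k)" if "a\<^sup>2 + b\<^sup>2 < 1" for a b
  proof -
    let ?p = "vector [a, b, l - a * x - b * k] :: real^3"
    have "plane_of ?p \<in> \<Psi>" using that by (intro plane_of_in_Psi) (simp add: chart_domain_def)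
    moreover have "Y \<in> plane_of ?p" by (simp add: Y in_plane_of)
    ultimately have "Z \<in> plane_of ?p" by (rule assms(3))
    then show ?thesis by (simp add: Z in_plane_of)
  qed
  from *[of 0 0] *[of "1/2" 0] *[of 0 "1/2"] show ?thesis
    by (simp add: Y Z power2_eq_square)
qed

lemma inj_on_plane_action: "inj_on plane_action motion_group"
proof (rule inj_onI)
  fix g h assume g: "g \<in> motion_group" and h: "h \<in> motion_group"
    and eq: "plane_action g = plane_action h"
  have img: "g ` D = h ` D" if "D \<in> \<Psi>" for D
    using fun_cong[OF eq, of D] that by (simp add: plane_action_def)
  have bij: "bij_betw g E21 E21" "bij_betw h E21 E21"
    and ext: "g \<in> extensional E21" "h \<in> extensional E21"
    using g h by (auto simp: motion_group_def bij_betw_motion motion_extensional)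
  show "g = h"
  proof (rule extensionalityI[OF ext])
    fix Y assume Y: "Y \<in> E21"
    then have "g Y \<in> h ` E21" using bij by (auto simp: bij_betw_def)
    then obtain Z where Z: "Z \<in> E21" "g Y = h Z" by auto
    \<comment> \<open>g and h agree on planes as sets, so Z lies in every euclidean plane through
      Y.\<close>
    have "Z \<in> D" if D: "D \<in> \<Psi>" "Y \<in> D" for D
    proof -
      have "h Z \<in> h ` D" using img[OF D(1)] D(2) Z(2) by (metis imageI)
      then show ?thesis
        using bij(2) Z(1) Psi_subset[OF D(1)] by (auto simp: bij_betw_def inj_on_def)
    qed
    then have "Z = Y" by (rule euclidean_planes_separate[OF Y Z(1)])
    then show "g Y = h Y" using Z(2) by simp
  qed
qed

lemma topspace_motion_topology: "topspace motion_topology = motion_group"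
proof -
  have "{(A, X). A \<in> SL2 \<and> X \<in> E21 \<and> motion A X \<in> motion_group} = SL2 \<times> E21"
    by (auto simp: motion_group_def)
  then have "motion_open motion_group"
    unfolding motion_open_def by simp
  then show ?thesis
    unfolding topspace_def openin_motion_topology by (auto simp: motion_open_def)
qed

section \<open>Generation of the motion group\<close>

text \<open>Each shear is a product of three boosts, and a matrix with nonzero lower left entry is a
  product of three shears.\<close>

lemma SL2_generated:
  assumes sym: "\<And>m1 m2. bmat m1 m2 \<in> M"
    and mult: "\<And>A B. A \<in> M \<Longrightarrow> B \<in> M \<Longrightarrow> A ** B \<in> M"
  shows "SL2 \<subseteq> M"
proof
  define shear_u shear_l :: "real \<Rightarrow> real^2^2"
    where "shear_u x = vector [vector [1, x], vector [0, 1]]"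
      and "shear_l x = vector [vector [1, 0], vector [x, 1]]" for x
  have symM: "A \<in> M" if "A \<in> SL2" "A$1$2 = A$2$1" "A$1$1 + A$2$2 > 0" for A
    using sym_SL2_eq_bmat[OF that] sym by metis
  \<comment> \<open>A shear times the diagonal matrix \<open>D\<close> with entries \<open>2\<close>, \<open>1/2\<close> has distinct positive
    eigenvalues, so it is \<open>P D P\<^sup>-\<^sup>1\<close> with \<open>P\<close> another shear, which is the product of the
    positive definite matrices \<open>P D P\<^sup>T\<close> and \<open>(P P\<^sup>T)\<^sup>-\<^sup>1\<close>.\<close>
  define S1 S2 :: "real \<Rightarrow> real^2^2"
    where "S1 e = vector [vector [2 + e\<^sup>2 / 2, e / 2], vector [e / 2, 1 / 2]]"
      and "S2 e = vector [vector [1, - e], vector [- e, 1 + e\<^sup>2]]" for e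
  define S3 :: "real^2^2" where "S3 = vector [vector [1 / 2, 0], vector [0, 2]]"
  have S1: "S1 e \<in> M" for e
    by (rule symM) (simp_all add: S1_def SL2_def det_2 power2_eq_square field_simps add_nonneg_pos)
  have S2: "S2 e \<in> M" for e
    by (rule symM) (simp_all add: S2_def SL2_def det_2 power2_eq_square add_pos_nonneg)
  have S3: "S3 \<in> M"
    by (rule symM) (simp_all add: S3_def SL2_def det_2)
  \<comment> \<open>\<open>S3\<close> cancels the diagonal part 2, 1/2 of
    \<open>S1 e ** S2 e\<close>; the remaining upper right entry is -3 e, whence e = -x/3.\<close>
  have "shear_u x = S1 (- x / 3) ** S2 (- x / 3) ** S3" for x
    by (simp add: shear_u_def S1_def S2_def S3_def mat22_eq_iff mat22_mult_nth
        power2_eq_square field_simps)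
  then have u: "shear_u x \<in> M" for x using S1 S2 S3 mult by metis
  \<comment> \<open>The transpose of the previous identity, all three factors being
    symmetric.\<close>
  have "shear_l x = S3 ** S2 (- x / 3) ** S1 (- x / 3)" for x
    by (simp add: shear_l_def S1_def S2_def S3_def mat22_eq_iff mat22_mult_nth
        power2_eq_square field_simps)
  then have l: "shear_l x \<in> M" for x using S1 S2 S3 mult by metis
  have ne: "A \<in> M" if "A \<in> SL2" "A$2$1 \<noteq> 0" for A
  proof -
    have "A = shear_u ((A$1$1 - 1) / A$2$1) ** shear_l (A$2$1) ** shear_u ((A$2$2 - 1) / A$2$1)"
      using that by (simp add: shear_u_def shear_l_def mat22_eq_iff mat22_mult_nth SL2_def det_2 field_simps)
    then show ?thesis using u l mult by metis
  qed
  fix A assume A: "A \<in> SL2"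
  show "A \<in> M"
  proof (cases "A$2$1 = 0")
    case True
    \<comment> \<open>Multiplying by \<open>shear_l 1\<close> moves the nonzero entry
      \<open>A$2$2\<close> into the lower left corner.\<close>
    have "shear_l 1 \<in> SL2" by (simp add: shear_l_def SL2_def det_2)
    moreover have "A$2$2 \<noteq> 0" using A True by (auto simp: SL2_def det_2)
    ultimately have "A ** shear_l 1 \<in> M"
      using True by (intro ne mult_in_SL2 A) (simp_all add: shear_l_def mat22_mult_nth)
    moreover have "A = A ** shear_l 1 ** shear_l (- 1)"
      by (simp add: shear_l_def mat22_eq_iff mat22_mult_nth)
    ultimately show ?thesis using l mult by metis
  qed (use ne A in blast)
qed

text \<open>The linear parts come from \<open>SL2_generated\<close>. The vectors V of translations
  in N are closed under addition and under the action of \<open>SL2\<close>, so one transversal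
  direction produces all of them.\<close>

lemma motion_group_generated:
  assumes comp: "\<And>g h. g \<in> N \<Longrightarrow> h \<in> N \<Longrightarrow> compose E21 g h \<in> N"
    and boost: "\<And>m1 m2. motion (bmat m1 m2) 0 \<in> N"
    and trans: "\<And>t. motion (mat 1) (t *\<^sub>R mk d1 d2 1) \<in> N"
  shows "motion_group \<subseteq> N"
proof
  have "SL2 \<subseteq> {A \<in> SL2. motion A 0 \<in> N}"
  proof (rule SL2_generated)
    fix A B assume "A \<in> {A \<in> SL2. motion A 0 \<in> N}" "B \<in> {A \<in> SL2. motion A 0 \<in> N}"
    moreover have "cj B 0 = 0" by (rule linear_0[OF linear_cj])
    ultimately show "A ** B \<in> {A \<in> SL2. motion A 0 \<in> N}"
      using comp[of "motion B 0" "motion A 0"] by (simp add: compose_motion mult_in_SL2)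
  qed (use boost in simp)
  then have lin: "motion A 0 \<in> N" if "A \<in> SL2" for A using that by blast
  define V where "V = {X \<in> E21. motion (mat 1) X \<in> N}"
  have V_add: "X + Y \<in> V" if "X \<in> V" "Y \<in> V" for X Y
    using that comp[of "motion (mat 1) Y" "motion (mat 1) X"]
    by (simp add: V_def compose_motion subspace_add subspace_E21)
  have V_cj: "cj A X \<in> V" if "A \<in> SL2" "X \<in> V" for A X
  proof -
    \<comment> \<open>Conjugating a translation by a linear motion transforms its vector by that
      motion.\<close>
    have "compose E21 (motion A 0) (compose E21 (motion (mat 1) X) (motion (adj2 A) 0))
        = motion (mat 1) (cj A X)"
      using that by (simp add: V_def compose_motion adj2_in_SL2 mult_in_SL2 adj2_mult_self)
    then show ?thesis
      using that comp lin adj2_in_SL2[of A] unfolding V_def by (metis (no_types, lifting) cj_in_E21 mem_Collect_eq)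
  qed
  have V_axis: "mk 0 0 l \<in> V" for l
  proof -
    \<comment> \<open>J acts as the half turn about the l-axis, so adding the image of a vector
      under J cancels its x and k parts.\<close>
    define J :: "real^2^2" where "J = vector [vector [0, 1], vector [- 1, 0]]"
    have "J \<in> SL2" by (simp add: J_def SL2_def det_2)
    moreover have "(l / 2) *\<^sub>R mk d1 d2 1 \<in> V"
      using trans[of "l / 2"] by (simp add: V_def)
    ultimately have "(l / 2) *\<^sub>R mk d1 d2 1 + cj J ((l / 2) *\<^sub>R mk d1 d2 1) \<in> V"
      using V_add V_cj by blast
    moreover have "cj J ((l / 2) *\<^sub>R mk d1 d2 1) = mk (- (l / 2 * d1)) (- (l / 2 * d2)) (l / 2)"
      by (simp add: cj_def J_def mat22_eq_iff mat22_mult_nth)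
    ultimately show ?thesis by simp
  qed
  have V_all: "mk x k l \<in> V" for x k l
  proof -
    \<comment> \<open>Chosen so that the boost of (0, 0, t) has x and k parts exactly x and k; a
      vector on the axis then corrects the l part.\<close>
    define t where "t = 1 / (2 * bu x k)"
    have t: "2 * (bu x k * t) = 1" using bu_pos[of x k] unfolding t_def by (simp del: bu_pos)
    have "cj (bmat x k) (mk 0 0 t) = mk (2 * (bu x k * t) * x) (2 * (bu x k * t) * k) (bu x k - t)"
      using t by (simp add: cj_bmat Let_def mult.commute)
    then have "mk x k (bu x k - t) + mk 0 0 (l - (bu x k - t)) \<in> V"
      using V_cj[OF bmat_in_SL2 V_axis[of t], of x k] V_axis by (intro V_add) (simp_all add: t)
    then show ?thesis by simp
  qed
  fix g assume "g \<in> motion_group"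
  then obtain A X where g: "A \<in> SL2" "X \<in> E21" "g = motion A X"
    by (auto simp: motion_group_def)
  obtain x k l where "X = mk x k l" using g(2) by (rule in_E21E)
  then have "motion (mat 1) X \<in> N" using V_all[of x k l] by (simp add: V_def)
  moreover have "compose E21 (motion (mat 1) X) (motion A 0) = g"
    using g by (simp add: compose_motion)
  ultimately show "g \<in> N" using comp lin g(1) by metis
qed

section \<open>Left translations of the loop as elements of the motion group\<close>

context transversal_base
begin

lemma left_translation_pm:
  assumes "x \<in> chart_domain"
  shows "left_translation \<Psi> pm (plane_of x) = plane_action (theta_to e x)"
  by (simp add: left_translation_def plane_action_def pm_eq_image assms)

lemma theta_eq_theta_to:
  obtains x where "x \<in> chart_domain" "theta m1 m2 t = theta_to e x"
proof -
  let ?x = "shift_chart t (boost_chart m1 m2 e)"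
  have x: "?x \<in> chart_domain" by (simp add: boost_chart_in_chart_domain e)
  moreover have "theta m1 m2 t = theta_to e ?x"
    using theta_to_eq_iff[OF e x, of "theta m1 m2 t"] by (simp add: theta_image e)
  ultimately show ?thesis using that by blast
qed

text \<open>Each element of \<open>Thetas\<close> is the left translation by its image of the base
  plane.\<close>

lemma left_translations_pm: "left_translation \<Psi> pm ` \<Psi> = plane_action ` Thetas"
proof -
  have "Thetas \<subseteq> theta_to e ` chart_domain"
  proof
    fix g assume "g \<in> Thetas"
    then obtain m1 m2 t where "g = theta m1 m2 t" by (auto simp: Thetas_def)
    then show "g \<in> theta_to e ` chart_domain"
      using theta_eq_theta_to[of m1 m2 t] by blast
  qed
  then have Thetas: "Thetas = theta_to e ` chart_domain" by (auto simp: theta_to_def)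
  have "left_translation \<Psi> pm ` \<Psi> = (\<lambda>x. left_translation \<Psi> pm (plane_of x)) ` chart_domain"
    by (subst (2) Psi_eq) (simp add: image_image)
  also have "\<dots> = (\<lambda>x. plane_action (theta_to e x)) ` chart_domain"
    by (simp add: left_translation_pm cong: image_cong_simp)
  also have "\<dots> = plane_action ` Thetas"
    unfolding Thetas image_image ..
  finally show ?thesis .
qed

lemma left_translations_topologically_generate_pm:
  "left_translations_topologically_generate pm"
proof -
  let ?N = "{g \<in> motion_group.
      plane_action g \<in> generate (BijGroup \<Psi>) (plane_action ` Thetas)}"
  have Thetas_N: "g \<in> ?N" if "g \<in> Thetas" for g
    using that Thetas_subset by (auto intro: generate.incl)
  have "motion_group \<subseteq> ?N"
  proof (rule motion_group_generated)
    fix g h assume "g \<in> ?N" "h \<in> ?N"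
    then show "compose E21 g h \<in> ?N"
      using generate.eng[of "plane_action g" "BijGroup \<Psi>" "plane_action ` Thetas" "plane_action h"]
      by (simp add: BijGroup_def plane_action_Bij compose_plane_action motion_group_compose)
  next
    fix m1 m2
    have "theta m1 m2 0 = motion (bmat m1 m2) 0" by (simp add: theta_def)
    moreover have "theta m1 m2 0 \<in> ?N" by (rule Thetas_N) simp
    ultimately show "motion (bmat m1 m2) 0 \<in> ?N" by (simp only:)
  next
    fix t
    have "theta 0 0 t = motion (mat 1) (t *\<^sub>R mk d1 d2 1)" by (simp add: theta_def bmat_0)
    moreover have "theta 0 0 t \<in> ?N" by (rule Thetas_N) simp
    ultimately show "motion (mat 1) (t *\<^sub>R mk d1 d2 1) \<in> ?N" by (simp only:)
  qed
  \<comment> \<open>The generated subgroup is already everything, so its closure is the whole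
    topological space.\<close>
  then have "?N = motion_group" by blast
  then have "motion_topology closure_of ?N = motion_group"
    using closure_of_topspace[of motion_topology] topspace_motion_topology by simp
  then show ?thesis
    unfolding left_translations_topologically_generate_def left_translations_pm
    using inj_on_plane_action Thetas_subset by blast
qed

text \<open>Test the Bol condition on a boost and the translation by (d1, d2, 1). Faithfulness turns
  it into membership in \<open>Thetas\<close>; evaluating at 0 kills the linear parts, so the
  boosted direction would be a multiple of (d1, d2, 1).\<close>

lemma not_is_bol_loop_pm: "\<not> is_bol_loop \<Psi> pm (plane_of e)"
proof
  assume bol: "is_bol_loop \<Psi> pm (plane_of e)"
  \<comment> \<open>The boost must move the direction of S: for d2 = 0 it creates a nonzero k part;
    for nonzero d2 it fixes the k part, so the multiple t would be 1, contradicting the x and l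
    parts.\<close>
  define m1 m2 :: real where "m1 = (if d2 = 0 then 0 else 1)" and "m2 = (if d2 = 0 then 1 else 0)"
  let ?\<delta> = "theta m1 m2 0" and ?\<tau> = "theta 0 0 1"
  have G: "?\<delta> \<in> motion_group" "?\<tau> \<in> motion_group" using Thetas_subset by auto
  obtain a where a: "a \<in> chart_domain" "?\<delta> = theta_to e a" by (rule theta_eq_theta_to)
  obtain b where b: "b \<in> chart_domain" "?\<tau> = theta_to e b" by (rule theta_eq_theta_to)
  have "compose \<Psi> (plane_action ?\<delta>) (compose \<Psi> (plane_action ?\<tau>) (plane_action ?\<delta>))
      \<in> plane_action ` Thetas"
    using bol a b plane_of_in_Psi left_translations_pm left_translation_pm[OF a(1)]
      left_translation_pm[OF b(1)]
    unfolding is_bol_loop_def by metis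
  then have "plane_action (compose E21 ?\<delta> (compose E21 ?\<tau> ?\<delta>)) \<in> plane_action ` Thetas"
    by (simp add: compose_plane_action G motion_group_compose)
  then have "compose E21 ?\<delta> (compose E21 ?\<tau> ?\<delta>) \<in> Thetas"
    using inj_on_image_mem_iff[OF inj_on_plane_action _ Thetas_subset] G motion_group_compose by blast
  then obtain n1 n2 t where "compose E21 ?\<delta> (compose E21 ?\<tau> ?\<delta>) = theta n1 n2 t"
    by (auto simp: Thetas_def)
  then have "?\<delta> (?\<tau> (?\<delta> 0)) = theta n1 n2 t 0"
    by (metis compose_eq zero_in_E21)
  moreover have cj0: "cj A 0 = 0" for A by (rule linear_0[OF linear_cj])
  ultimately have eq: "cj (bmat m1 m2) (mk d1 d2 1) = mk (t * d1) (t * d2) t"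
    by (simp add: theta_def motion_apply bmat_0)
  show False
  proof (cases "d2 = 0")
    case True
    then show ?thesis using eq bu_pos[of 0 1] by (simp add: cj_bmat m1_def m2_def Let_def)
  next
    case False
    then have "d1 + bu 1 0 = 0" "bu 1 0 * (d1 + bu 1 0) = 1"
      using eq by (auto simp: cj_bmat m1_def m2_def Let_def)
    then show ?thesis by simp
  qed
qed

end

section \<open>From the geometric hypotheses to the normalised direction of S\<close>

theorem mainTheorem3:
  fixes \<Lambda> :: "(real^2^2 \<Rightarrow> real^2^2) set"
    and S P :: "(real^2^2) set"
  assumes "one_dim_translation_group \<Lambda>"
    and "is_line S" and "0 \<in> S"
    and "\<forall>\<omega> \<in> \<Lambda>. \<omega> ` S = S"
    and "\<forall>D \<in> \<Psi>. \<exists>!Y. Y \<in> S \<inter> D"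
  shows "sharply_transitive_on_planes (Theta_motions \<Lambda>) \<and>
    (P \<in> \<Psi> \<and> 0 \<in> P \<longrightarrow>
       differentiable_loop plane_chart \<Psi> (plane_mult (Theta_motions \<Lambda>) P) P \<and>
       left_translations_topologically_generate (plane_mult (Theta_motions \<Lambda>) P) \<and>
       \<not> is_bol_loop \<Psi> (plane_mult (Theta_motions \<Lambda>) P) P)"
proof -
  obtain W where W: "W \<subseteq> E21" "subspace W" "dim W = 1" "\<Lambda> = translation ` W"
    using assms(1) by (auto simp: one_dim_translation_group_def)
  have S: "S \<subseteq> E21" "affine S" "aff_dim S = 1" using assms(2) by (auto simp: is_line_def)
  have subS: "subspace S" using S(2) assms(3) by (simp add: subspace_affine)
  have dimS: "dim S = 1" using aff_dim_subspace[OF subS] S(3) by simp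
  \<comment> \<open>Each translation of the invariant line S carries 0 into S; equal dimensions then
    give W = S.\<close>
  have "W \<subseteq> S"
  proof
    fix w assume "w \<in> W"
    then have "translation w ` S = S" using assms(4) W(4) by blast
    moreover have "translation w 0 = w" using \<open>w \<in> W\<close> by (simp add: translation_def motion_apply)
    ultimately show "w \<in> S" using assms(3) by (metis imageI)
  qed
  then have WS: "W = S" using W subS dimS by (intro subspace_dim_equal) auto
  obtain v where v: "v \<in> S" "v \<noteq> 0"
    using dimS by (metis dim_eq_0 subsetI singletonI zero_neq_one)
  obtain x k l where v_eq: "v = mk x k l" using v(1) S(1) by (blast elim: in_E21E)
  have ne: "l - x * p$1 - k * p$2 \<noteq> 0" if "p \<in> chart_domain" for p
  proof
    assume 0: "l - x * p$1 - k * p$2 = 0"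
    \<comment> \<open>If v were parallel to the planes with slopes p1, p2, the one through the
      origin would meet S in both 0 and v.\<close>
    let ?D = "plane_of (vector [p$1, p$2, 0])"
    have "?D \<in> \<Psi>" using that by (intro plane_of_in_Psi) (simp add: chart_domain_def)
    moreover have "v \<in> S \<inter> ?D" using v 0 by (simp add: v_eq in_plane_of algebra_simps)
    moreover have "0 \<in> S \<inter> ?D" using assms(3) in_plane_of[of 0 0 0] by simp
    ultimately show False using assms(5) v(2) by blast
  qed
  \<comment> \<open>The plane l = 0 is euclidean, so S is not contained in it and its direction can
    be scaled to l-coordinate 1.\<close>
  have l: "l \<noteq> 0" using ne[of 0] by (simp add: chart_domain_def)
  define d1 d2 where "d1 = x / l" and "d2 = k / l"
  interpret transversal d1 d2
  proof
    fix p :: "real^3" assume "p \<in> chart_domain"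
    moreover have "1 - d1 * p$1 - d2 * p$2 = (l - x * p$1 - k * p$2) / l"
      using l by (simp add: d1_def d2_def diff_divide_distrib)
    ultimately show "1 - d1 * p$1 - d2 * p$2 \<noteq> 0" using ne l by simp
  qed
  have "mk d1 d2 1 = (1 / l) *\<^sub>R v" using l by (simp add: v_eq d1_def d2_def)
  then have d_S: "mk d1 d2 1 \<in> S" using subspace_scale[OF subS v(1)] by metis
  have "span {mk d1 d2 1} \<subseteq> S" using d_S subS by (intro span_minimal) auto
  moreover have "dim (span {mk d1 d2 1}) = 1" by (simp add: dim_span)
  ultimately have "S = span {mk d1 d2 1}"
    using subS dimS by (intro subspace_dim_equal[symmetric]) auto
  then have "\<Lambda> = {motion (mat 1) (t *\<^sub>R mk d1 d2 1) | t. True}"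
    unfolding W(4) WS by (auto simp: span_singleton translation_def)
  then have Theta: "Theta_motions \<Lambda> = Thetas"
    unfolding Theta_motions_def Thetas_def Sigma_motions_eq theta_eq_compose by blast
  have "differentiable_loop plane_chart \<Psi> (plane_mult Thetas P) P \<and>
       left_translations_topologically_generate (plane_mult Thetas P) \<and>
       \<not> is_bol_loop \<Psi> (plane_mult Thetas P) P" if "P \<in> \<Psi>"
  proof -
    obtain r where r: "r \<in> chart_domain" "P = plane_of r" using \<open>P \<in> \<Psi>\<close> by (rule Psi_plane_of)
    interpret transversal_base d1 d2 r by unfold_locales (rule r(1))
    show ?thesis
      unfolding r(2)
      using differentiable_loop_pm left_translations_topologically_generate_pm not_is_bol_loop_pm
      by blast
  qed
  then show ?thesis unfolding Theta using sharply_transitive_Thetas by blast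
qed

end
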